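(* Let $\mathcal{M}=(U,\mathcal{I})$ be a matroid of rank $k$, $f\colon 2^U\to\mathbb{R}_+$ a monotone submodular function, $0<\varepsilon\le1$, and let swap be a right continuous swap procedure that is $(\beta,\eta)$-approximate for some $\beta\in(0,1]$, $\eta\ge0$. Then the Greedy Swap Poisson Process run with $\mathcal{M}$, $\varepsilon$ and swap finds $A\in\mathcal{B}$ satisfying $\mathbb{E}[f(A)]\ge(1-\varepsilon)(1-\eta/\beta)(1-e^{-\beta})f(O)$ using in expectation $k\ln(1/\varepsilon)$ calls to the swap procedure, where $O\in\arg\max\{f(S):S\in\mathcal{I}\}$ is an optimal base.
   Context: $\mathcal{B}$ is the set of bases of $\mathcal{M}$. Submodular: $f(S+i)-f(S)\ge f(T+i)-f(T)$ for $S\subseteq T\subseteq U$, $i\notin T$; monotone: $f(S)\le f(T)$ for $S\subseteq T$. $F$ is the multilinear extension of $f$, $\nabla_iF$ its partial derivative in coordinate $i$, $\mathbf{1}_A$ the indicator vector of $A$. A swap procedure is a (possibly randomized) algorithm that, given $A\in\mathcal{B}$ and $t\in[\varepsilon,1]$, returns $(i,j)$ with $i\in A$, $j\in U$, $A-i+j\in\mathcal{B}$; $p_{(i,j)}(t,A)$ is the probability it returns $(i,j)$; it is right continuous if $t\mapsto p_{(i,j)}(t,A)$ is right continuous on $[\varepsilon,1]$. Fix an optimal base $O\in\arg\max\{f(S):S\in\mathcal{B}\}$. The procedure is $(\beta,\eta)$-approximate if for all $A\in\mathcal{B}$, $t\in[\varepsilon,1]$: $\mathbb{E}_{(i,j)\sim\mathrm{swap}(t,A)}[\nabla_jF(t\mathbf{1}_A)-\nabla_iF(t\mathbf{1}_A)]\ge\frac{\beta}{k}\sum_{o\in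 O}\nabla_oF(t\mathbf{1}_A)-\frac1k\sum_{a\in A}\nabla_aF(t\mathbf{1}_A)-\frac{\eta}{k}f(O)$. Greedy Swap Poisson Process: start at $t=\varepsilon$ with an arbitrary base $A$; simulate a non-homogeneous Poisson process with rate $\lambda(t)=k/t$; at each event time $t<1$ call $(i,j)\leftarrow\mathrm{swap}(t,A)$ and set $A\leftarrow A-i+j$; return $A$ at time $1$. *)

theory Defs
  imports "HOL-Probability.Probability"
begin

section \<open>Matroids and set functions\<close>

locale matroid =
  fixes U :: "'a set" and Ind :: "'a set set"
  assumes finite_ground: "finite U"
    and indep_subset_ground: "S \<in> Ind \<Longrightarrow> S \<subseteq> U"
    and indep_empty: "{} \<in> Ind"
    and indep_hereditary: "T \<in> Ind \<Longrightarrow> S \<subseteq> T \<Longrightarrow> S \<in> Ind"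
    and indep_augment: "S \<in> Ind \<Longrightarrow> T \<in> Ind \<Longrightarrow> card S < card T \<Longrightarrow> \<exists>x\<in>T - S. insert x S \<in> Ind"

definition matroid_rank :: "'a set set \<Rightarrow> nat" where
  "matroid_rank Ind = Max (card ` Ind)"

definition bases :: "'a set set \<Rightarrow> 'a set set" where
  "bases Ind = {B \<in> Ind. \<forall>S\<in>Ind. B \<subseteq> S \<longrightarrow> S = B}"

definition monotone_set_fun :: "'a set \<Rightarrow> ('a set \<Rightarrow> real) \<Rightarrow> bool" where
  "monotone_set_fun U f \<longleftrightarrow> (\<forall>S T. S \<subseteq> T \<longrightarrow> T \<subseteq> U \<longrightarrow> f S \<le> f T)"

definition submodular :: "'a set \<Rightarrow> ('a set \<Rightarrow> real) \<Rightarrow> bool" where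
  "submodular U f \<longleftrightarrow>
     (\<forall>S T i. S \<subseteq> T \<longrightarrow> T \<subseteq> U \<longrightarrow> i \<in> U - T \<longrightarrow> f (insert i S) - f S \<ge> f (insert i T) - f T)"

definition optimal_base :: "'a set set \<Rightarrow> ('a set \<Rightarrow> real) \<Rightarrow> 'a set \<Rightarrow> bool" where
  "optimal_base Ind f Opt \<longleftrightarrow> Opt \<in> bases Ind \<and> is_arg_max f (\<lambda>S. S \<in> Ind) Opt"

definition multilinear_ext :: "'a set \<Rightarrow> ('a set \<Rightarrow> real) \<Rightarrow> ('a \<Rightarrow> real) \<Rightarrow> real" where
  "multilinear_ext U f x = (\<Sum>S\<in>Pow U. f S * (\<Prod>i\<in>S. x i) * (\<Prod>i\<in>U - S. 1 - x i))"

definition partial_deriv :: "(('a \<Rightarrow> real) \<Rightarrow> real) \<Rightarrow> 'a \<Rightarrow> ('a \<Rightarrow> real) \<Rightarrow> real" where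
  "partial_deriv F i x = deriv (\<lambda>s. F (x(i := s))) (x i)"

text \<open>The gradient of the multilinear extension at \<open>t\<close> times the indicator vector of \<open>A\<close>.\<close>

definition grad_at :: "'a set \<Rightarrow> ('a set \<Rightarrow> real) \<Rightarrow> real \<Rightarrow> 'a set \<Rightarrow> 'a \<Rightarrow> real" where
  "grad_at U f t A i = partial_deriv (multilinear_ext U f) i (\<lambda>u. t * indicator A u)"


section \<open>Swap procedures\<close>

text \<open>
  A randomized swap procedure is represented by the distribution of its output pair, so that
  the probability of returning \<open>(i, j)\<close> on input \<open>t\<close>, \<open>A\<close> is \<open>pmf (swap t A) (i, j)\<close>.
\<close>

definition apply_swap :: "'a set \<Rightarrow> 'a \<times> 'a \<Rightarrow> 'a set" where
  "apply_swap A = (\<lambda>(i, j). insert j (A - {i}))"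

definition swap_procedure ::
    "'a set \<Rightarrow> 'a set set \<Rightarrow> real \<Rightarrow> (real \<Rightarrow> 'a set \<Rightarrow> ('a \<times> 'a) pmf) \<Rightarrow> bool" where
  "swap_procedure U Ind \<epsilon> swap \<longleftrightarrow>
     (\<forall>A\<in>bases Ind. \<forall>t\<in>{\<epsilon>..1}. \<forall>(i, j)\<in>set_pmf (swap t A).
        i \<in> A \<and> j \<in> U \<and> apply_swap A (i, j) \<in> bases Ind)"

definition right_continuous_swap ::
    "'a set \<Rightarrow> 'a set set \<Rightarrow> real \<Rightarrow> (real \<Rightarrow> 'a set \<Rightarrow> ('a \<times> 'a) pmf) \<Rightarrow> bool" where
  "right_continuous_swap U Ind \<epsilon> swap \<longleftrightarrow>
     (\<forall>A\<in>bases Ind. \<forall>i\<in>U. \<forall>j\<in>U. \<forall>t\<in>{\<epsilon>..1}.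
        continuous (at t within {t..1}) (\<lambda>s. pmf (swap s A) (i, j)))"

definition approximate_swap ::
    "'a set \<Rightarrow> 'a set set \<Rightarrow> ('a set \<Rightarrow> real) \<Rightarrow> 'a set \<Rightarrow> real \<Rightarrow> real \<Rightarrow> real \<Rightarrow>
      (real \<Rightarrow> 'a set \<Rightarrow> ('a \<times> 'a) pmf) \<Rightarrow> bool" where
  "approximate_swap U Ind f Opt \<epsilon> \<beta> \<eta> swap \<longleftrightarrow>
     (\<forall>A\<in>bases Ind. \<forall>t\<in>{\<epsilon>..1}.
        measure_pmf.expectation (swap t A) (\<lambda>(i, j). grad_at U f t A j - grad_at U f t A i)
          \<ge> \<beta> / real (matroid_rank Ind) * (\<Sum>u\<in>Opt. grad_at U f t A u)
             - 1 / real (matroid_rank Ind) * (\<Sum>a\<in>A. grad_at U f t A a)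
             - \<eta> / real (matroid_rank Ind) * f Opt)"


section \<open>Poisson processes\<close>

text \<open>
  \<open>N t \<omega>\<close> is the number of events up to and including time \<open>t\<close>. Monotonicity of the paths makes
  the truncated subtractions on \<open>nat\<close> exact. Two events at the same time are not
  excluded explicitly; the distributional conditions make them a null event.
\<close>

definition nonhom_poisson_process ::
    "'w measure \<Rightarrow> (real \<Rightarrow> real) \<Rightarrow> real \<Rightarrow> real \<Rightarrow> (real \<Rightarrow> 'w \<Rightarrow> nat) \<Rightarrow> bool" where
  "nonhom_poisson_process M rate a b N \<longleftrightarrow>
     prob_space M \<and>
     (\<forall>t\<in>{a..b}. N t \<in> M \<rightarrow>\<^sub>M count_space UNIV) \<and>
     (\<forall>\<omega>\<in>space M. N a \<omega> = 0 \<and> mono_on {a..b} (\<lambda>t. N t \<omega>) \<and>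
        (\<forall>t\<in>{a..b}. continuous (at t within {t..b}) (\<lambda>s. N s \<omega>))) \<and>
     (\<forall>n (s :: nat \<Rightarrow> real). (\<forall>i\<le>n. s i \<in> {a..b}) \<longrightarrow> (\<forall>i<n. s i \<le> s (Suc i)) \<longrightarrow>
        prob_space.indep_vars M (\<lambda>_. count_space UNIV)
          (\<lambda>i \<omega>. N (s (Suc i)) \<omega> - N (s i) \<omega>) {..<n}) \<and>
     (\<forall>s\<in>{a..b}. \<forall>t\<in>{s..b}. \<forall>n.
        measure M {\<omega> \<in> space M. N t \<omega> - N s \<omega> = n}
          = integral {s..t} rate ^ n / fact n * exp (- integral {s..t} rate))"


section \<open>The Greedy Swap Poisson Process\<close>

text \<open>
  Events and calls are numbered from \<open>0\<close>. \<open>event_time \<epsilon> N n \<omega>\<close> is the time of event \<open>n\<close> and is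
  meaningful only if \<open>n < N 1 \<omega>\<close>. Only events strictly before time \<open>1\<close> trigger a call.
\<close>

definition event_time :: "real \<Rightarrow> (real \<Rightarrow> 'w \<Rightarrow> nat) \<Rightarrow> nat \<Rightarrow> 'w \<Rightarrow> real" where
  "event_time \<epsilon> N n \<omega> = Inf {t \<in> {\<epsilon>..1}. n < N t \<omega>}"

definition num_calls :: "real \<Rightarrow> (real \<Rightarrow> 'w \<Rightarrow> nat) \<Rightarrow> 'w \<Rightarrow> nat" where
  "num_calls \<epsilon> N \<omega> = card {n. n < N 1 \<omega> \<and> event_time \<epsilon> N n \<omega> < 1}"

text \<open>
  \<open>S n \<omega>\<close> is the pair returned by call \<open>n\<close>, and \<open>current_set A\<^sub>0 S n \<omega>\<close> the set held
  by the algorithm after the first \<open>n\<close> calls.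
\<close>

primrec current_set :: "'a set \<Rightarrow> (nat \<Rightarrow> 'w \<Rightarrow> 'a \<times> 'a) \<Rightarrow> nat \<Rightarrow> 'w \<Rightarrow> 'a set" where
  "current_set A\<^sub>0 S 0 \<omega> = A\<^sub>0"
| "current_set A\<^sub>0 S (Suc n) \<omega> = apply_swap (current_set A\<^sub>0 S n \<omega>) (S n \<omega>)"

definition output_set ::
    "real \<Rightarrow> 'a set \<Rightarrow> (real \<Rightarrow> 'w \<Rightarrow> nat) \<Rightarrow> (nat \<Rightarrow> 'w \<Rightarrow> 'a \<times> 'a) \<Rightarrow> 'w \<Rightarrow> 'a set" where
  "output_set \<epsilon> A\<^sub>0 N S \<omega> = current_set A\<^sub>0 S (num_calls \<epsilon> N \<omega>) \<omega>"

text \<open>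
  The information generated by the whole event process and the results of the
  first \<open>n\<close> calls.
\<close>

definition history ::
    "'w measure \<Rightarrow> real \<Rightarrow> (real \<Rightarrow> 'w \<Rightarrow> nat) \<Rightarrow> (nat \<Rightarrow> 'w \<Rightarrow> 'a \<times> 'a) \<Rightarrow> nat \<Rightarrow> 'w measure" where
  "history M \<epsilon> N S n = sigma (space M)
     ({N t -` X \<inter> space M | t X. t \<in> {\<epsilon>..1}} \<union> {S m -` X \<inter> space M | m X. m < n})"

text \<open>
  A run of the algorithm on the probability space \<open>M\<close>. The last conjunct says that each call uses
  fresh randomness: given all event times and all earlier results, the result of call \<open>n\<close> has the
  distribution of \<open>swap\<close> on the current time and set. Conditioning also on the
  future event times expresses that the event process is independent of the randomness of the calls.
  The values \<open>S n \<omega>\<close> with \<open>n \<ge> num_calls \<epsilon> N \<omega>\<close> are dummies on which nothing depends.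
\<close>

definition greedy_swap_poisson_process ::
    "'a set \<Rightarrow> 'a set set \<Rightarrow> real \<Rightarrow> (real \<Rightarrow> 'a set \<Rightarrow> ('a \<times> 'a) pmf) \<Rightarrow> 'a set \<Rightarrow>
      'w measure \<Rightarrow> (real \<Rightarrow> 'w \<Rightarrow> nat) \<Rightarrow> (nat \<Rightarrow> 'w \<Rightarrow> 'a \<times> 'a) \<Rightarrow> bool" where
  "greedy_swap_poisson_process U Ind \<epsilon> swap A\<^sub>0 M N S \<longleftrightarrow>
     A\<^sub>0 \<in> bases Ind \<and>
     nonhom_poisson_process M (\<lambda>t. real (matroid_rank Ind) / t) \<epsilon> 1 N \<and>
     (\<forall>n. S n \<in> M \<rightarrow>\<^sub>M count_space (U \<times> U)) \<and>
     (\<forall>n. \<forall>i\<in>U. \<forall>j\<in>U. AE \<omega> in M. n < num_calls \<epsilon> N \<omega> \<longrightarrow>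
        real_cond_exp M (history M \<epsilon> N S n) (indicator {\<omega> \<in> space M. S n \<omega> = (i, j)}) \<omega>
          = pmf (swap (event_time \<epsilon> N n \<omega>) (current_set A\<^sub>0 S n \<omega>)) (i, j))"

end

theory Submission
  imports Defs
begin

text \<open>
  Let \<open>F\<close> be the multilinear extension of \<open>f\<close> and let \<open>X\<^sub>t\<close> be the base held at time \<open>t\<close>. The
  potential \<open>g t = E [F (t 1\<^bsub>X\<^sub>t\<^esub>)]\<close> starts nonnegative and ends at \<open>E [f X\<^sub>1]\<close>. With \<open>X\<^sub>t = A\<close> fixed
  it grows at rate \<open>\<Sum>a\<in>A. \<nabla>\<^sub>a F\<close>. By submodularity a swap \<open>(i, j)\<close> gains at least
  \<open>t (\<nabla>\<^sub>j F - \<nabla>\<^sub>i F)\<close>; swaps occur at rate \<open>k / t\<close>, so by \<open>(\<beta>, \<eta>)\<close>-approximation they contribute at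
  least \<open>\<beta> (\<Sum>o\<in>O. \<nabla>\<^sub>o F) - (\<Sum>a\<in>A. \<nabla>\<^sub>a F) - \<eta> f O\<close>. The terms over \<open>A\<close> cancel, and
  \<open>\<Sum>o\<in>O. \<nabla>\<^sub>o F \<ge> f O - F\<close>, whence \<open>g' \<ge> (\<beta> - \<eta>) f O - \<beta> g\<close>, and Gronwall's inequality gives the
  bound. Rather than differentiating \<open>g\<close>, one splits \<open>{\<epsilon>..1}\<close> into short steps: over a step of
  length \<open>h\<close> the cases of no event and of exactly one event already account for \<open>g\<close> up to an error
  \<open>o(h)\<close>. This only uses that the increment of the Poisson process over the step is independent of
  \<open>X\<^sub>t\<close>, which is proved by induction on the number of calls.
\<close>

section \<open>Multilinear extension\<close>

text \<open>Swap probabilities are never compared at two different times: the approximation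
  inequality is applied at the actual, random event time, and only the gradients, which are
  polynomials in the time and hence uniformly continuous, are moved to the start of the step. Right
  continuity of the swap enters through the measurability of its probabilities as functions of the
  event time. The obstacle is that calls depend on the event times, so the current base depends on
  the event process; what holds is independence from the increments after the current time. Since
  the law of a call is given conditionally on the entire event process, each call can be integrated
  out: its result is replaced by a swap probability at an event time, which is a function of the
  past of the event process alone. Gronwall's inequality on an interval of length
  \<open>1 - \<epsilon>\<close> yields \<open>1 - exp (- (\<beta> * (1 - \<epsilon>)))\<close>, and
  convexity of \<open>exp\<close> bounds this below by
  \<open>(1 - \<epsilon>) * (1 - exp (- \<beta>))\<close>; this is the origin of the factor
  \<open>1 - \<epsilon>\<close>.\<close>

lemma sum_Pow_split:
  fixes g :: "'a set \<Rightarrow> 'b::comm_monoid_add"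
  assumes "finite U" "i \<in> U"
  shows "(\<Sum>S\<in>Pow U. g S) = (\<Sum>S\<in>Pow (U - {i}). g (insert i S) + g S)"
proof -
  have U: "U = insert i (U - {i})" using assms by auto
  have inj: "inj_on (insert i) (Pow (U - {i}))" by (rule inj_onI) blast
  have "(\<Sum>S\<in>Pow U. g S) = (\<Sum>S\<in>Pow (U - {i}) \<union> insert i ` Pow (U - {i}). g S)"
    by (subst U, subst Pow_insert) simp
  also have "\<dots> = (\<Sum>S\<in>Pow (U - {i}). g S) + (\<Sum>S\<in>insert i ` Pow (U - {i}). g S)"
    using assms by (intro sum.union_disjoint) auto
  also have "(\<Sum>S\<in>insert i ` Pow (U - {i}). g S) = (\<Sum>S\<in>Pow (U - {i}). g (insert i S))"
    using inj by (simp add: sum.reindex)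
  finally show ?thesis by (simp add: sum.distrib add.commute)
qed

lemma multilinear_ext_split:
  assumes "finite U" "i \<in> U"
  shows "multilinear_ext U h x =
    (\<Sum>S\<in>Pow (U - {i}). (x i * h (insert i S) + (1 - x i) * h S) * (\<Prod>j\<in>S. x j) * (\<Prod>j\<in>U - {i} - S. 1 - x j))"
  unfolding multilinear_ext_def
proof (subst sum_Pow_split[OF assms], rule sum.cong)
  fix S assume S: "S \<in> Pow (U - {i})"
  then have fin: "finite S" using assms finite_subset by blast
  have a: "(\<Prod>j\<in>insert i S. x j) = x i * (\<Prod>j\<in>S. x j)"
    using fin S by (subst prod.insert) auto
  have b: "U - insert i S = U - {i} - S" by auto
  have c: "(\<Prod>j\<in>U - S. 1 - x j) = (1 - x i) * (\<Prod>j\<in>U - {i} - S. 1 - x j)"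
  proof -
    have "U - S = insert i (U - {i} - S)" using S assms by auto
    then show ?thesis using assms by simp
  qed
  show "h (insert i S) * (\<Prod>j\<in>insert i S. x j) * (\<Prod>j\<in>U - insert i S. 1 - x j)
        + h S * (\<Prod>j\<in>S. x j) * (\<Prod>j\<in>U - S. 1 - x j) =
      (x i * h (insert i S) + (1 - x i) * h S) * (\<Prod>j\<in>S. x j) * (\<Prod>j\<in>U - {i} - S. 1 - x j)"
    by (simp add: a b c algebra_simps)
qed simp

lemma multilinear_ext_cong:
  "(\<And>S. S \<subseteq> U \<Longrightarrow> g S = h S) \<Longrightarrow> (\<And>i. i \<in> U \<Longrightarrow> x i = y i) \<Longrightarrow>
    multilinear_ext U g x = multilinear_ext U h y"
  unfolding multilinear_ext_def
  by (intro sum.cong refl arg_cong2[where f="(*)"] prod.cong) auto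

lemma multilinear_ext_diff:
  "multilinear_ext U (\<lambda>S. g S - h S) x = multilinear_ext U g x - multilinear_ext U h x"
  by (simp add: multilinear_ext_def left_diff_distrib sum_subtractf)

lemma multilinear_ext_cmult:
  "multilinear_ext U (\<lambda>S. c * h S) x = c * multilinear_ext U h x"
  by (simp add: multilinear_ext_def sum_distrib_left mult_ac)

lemma multilinear_ext_sum:
  "multilinear_ext U (\<lambda>S. \<Sum>i\<in>I. h i S) x = (\<Sum>i\<in>I. multilinear_ext U (h i) x)"
  unfolding multilinear_ext_def
  by (subst sum.swap) (simp add: sum_distrib_right)

text \<open>The weights of the sets are the terms in the expansion of the product of all
  \<open>x i + (1 - x i)\<close>, each factor being \<open>1\<close>.\<close>

lemma multilinear_ext_const:
  fixes x :: "'a \<Rightarrow> real"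
  assumes "finite U"
  shows "multilinear_ext U (\<lambda>S. c) x = c"
proof -
  have "(\<Prod>i\<in>U. x i + (1 - x i)) = (\<Sum>S\<in>Pow U. (\<Prod>i\<in>S. x i) * (\<Prod>i\<in>U - S. 1 - x i))"
    by (rule prod_add[OF assms])
  then show ?thesis
    by (simp add: multilinear_ext_def mult.assoc sum_distrib_left[symmetric])
qed

lemma multilinear_ext_mono:
  assumes "finite U" "\<And>S. S \<subseteq> U \<Longrightarrow> g S \<le> h S" "\<And>i. i \<in> U \<Longrightarrow> 0 \<le> x i \<and> x i \<le> 1"
  shows "multilinear_ext U g x \<le> multilinear_ext U h x"
  unfolding multilinear_ext_def
proof (intro sum_mono mult_right_mono)
  fix S assume "S \<in> Pow U"
  then show "g S \<le> h S" "0 \<le> (\<Prod>i\<in>S. x i)" "0 \<le> (\<Prod>i\<in>U - S. 1 - x i)"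
    using assms by (auto intro!: prod_nonneg)
qed

text \<open>The extension is affine in each coordinate. Writing both coefficients with
  \<open>insert i S\<close> and \<open>S - {i}\<close> makes them multilinear extensions at the same
  point, independent of \<open>x i\<close>. The partial derivative is then again a multilinear
  extension, and its sign and monotonicity can be read off from a set function.\<close>

lemma multilinear_ext_upd:
  assumes "finite U" "i \<in> U"
  shows "multilinear_ext U h (x(i := s)) =
    s * multilinear_ext U (\<lambda>S. h (insert i S)) x + (1 - s) * multilinear_ext U (\<lambda>S. h (S - {i})) x"
proof -
  have eq: "(\<Prod>j\<in>S. (x(i := s)) j) = (\<Prod>j\<in>S. x j)"
    "(\<Prod>j\<in>U - {i} - S. 1 - (x(i := s)) j) = (\<Prod>j\<in>U - {i} - S. 1 - x j)"
    "S - {i} = S"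
    if "S \<in> Pow (U - {i})" for S
    using that by (auto intro!: prod.cong)
  show ?thesis
    unfolding multilinear_ext_split[OF assms] sum_distrib_left sum.distrib[symmetric]
  proof (intro sum.cong refl)
    fix S assume "S \<in> Pow (U - {i})"
    note eq = eq[OF this]
    show "((x(i := s)) i * h (insert i S) + (1 - (x(i := s)) i) * h S) * prod (x(i := s)) S
          * (\<Prod>j\<in>U - {i} - S. 1 - (x(i := s)) j) =
        s * ((x i * h (insert i (insert i S)) + (1 - x i) * h (insert i S)) * prod x S
          * (\<Prod>j\<in>U - {i} - S. 1 - x j)) +
        (1 - s) * ((x i * h (insert i S - {i}) + (1 - x i) * h (S - {i})) * prod x S
          * (\<Prod>j\<in>U - {i} - S. 1 - x j))"
      using eq(3) unfolding eq(1,2) by (simp add: insert_absorb algebra_simps)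
  qed
qed

lemma partial_deriv_multilinear_ext:
  assumes "finite U" "i \<in> U"
  shows "partial_deriv (multilinear_ext U h) i x =
    multilinear_ext U (\<lambda>S. h (insert i S) - h (S - {i})) x"
proof -
  have "((\<lambda>s. multilinear_ext U h (x(i := s))) has_field_derivative
      multilinear_ext U (\<lambda>S. h (insert i S) - h (S - {i})) x) (at (x i))"
    unfolding multilinear_ext_upd[OF assms] multilinear_ext_diff
    by (auto intro!: derivative_eq_intros)
  then show ?thesis unfolding partial_deriv_def by (rule DERIV_imp_deriv)
qed

lemma multilinear_ext_upd_diff:
  assumes "finite U" "i \<in> U"
  shows "multilinear_ext U h (x(i := s)) - multilinear_ext U h x =
    (s - x i) * partial_deriv (multilinear_ext U h) i x"
  using multilinear_ext_upd[OF assms, of h x s] multilinear_ext_upd[OF assms, of h x "x i"]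
  by (simp add: partial_deriv_multilinear_ext[OF assms] multilinear_ext_diff algebra_simps)

text \<open>The coordinates in \<open>B\<close> are raised one at a time; each change is affine,
  with a slope that is the extension of a nonnegative function.\<close>

lemma multilinear_ext_override_mono:
  assumes U: "finite U" "B \<subseteq> U"
    and h: "\<And>S T. S \<subseteq> T \<Longrightarrow> T \<subseteq> U \<Longrightarrow> h S \<le> h T"
    and x: "\<And>i. i \<in> U \<Longrightarrow> 0 \<le> x i \<and> x i \<le> y i \<and> y i \<le> 1"
  shows "multilinear_ext U h x \<le> multilinear_ext U h (override_on x y B)"
proof -
  have "finite B" using U finite_subset by blast
  then show ?thesis using U(2)
  proof (induction B rule: finite_induct)
    case (insert b B)
    let ?z = "override_on x y B"
    have z: "override_on x y (insert b B) = ?z(b := y b)"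
      by (auto simp: override_on_def)
    have b: "b \<in> U" "?z b = x b" using insert by (auto simp: override_on_def)
    have "0 = multilinear_ext U (\<lambda>S. 0) ?z" using U by (simp add: multilinear_ext_const)
    also have "\<dots> \<le> multilinear_ext U (\<lambda>S. h (insert b S) - h (S - {b})) ?z"
    proof (intro multilinear_ext_mono U)
      show "0 \<le> h (insert b S) - h (S - {b})" if "S \<subseteq> U" for S
        using h[of "S - {b}" "insert b S"] that b by auto
      show "0 \<le> ?z i \<and> ?z i \<le> 1" if "i \<in> U" for i
        using x[OF that] by (auto simp: override_on_def)
    qed
    finally have "0 \<le> (y b - ?z b) * multilinear_ext U (\<lambda>S. h (insert b S) - h (S - {b})) ?z"
      using x b by simp
    then have "multilinear_ext U h ?z \<le> multilinear_ext U h (?z(b := y b))"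
      using multilinear_ext_upd_diff[OF U(1) b(1), of h ?z "y b"]
      by (simp add: partial_deriv_multilinear_ext[OF U(1) b(1)])
    then show ?case using insert by (simp add: z del: fun_upd_apply)
  qed simp
qed

lemma multilinear_ext_mono_point:
  assumes "finite U" "\<And>S T. S \<subseteq> T \<Longrightarrow> T \<subseteq> U \<Longrightarrow> h S \<le> h T"
    and "\<And>i. i \<in> U \<Longrightarrow> 0 \<le> x i \<and> x i \<le> y i \<and> y i \<le> 1"
  shows "multilinear_ext U h x \<le> multilinear_ext U h y"
proof -
  have "multilinear_ext U h x \<le> multilinear_ext U h (override_on x y U)"
    by (intro multilinear_ext_override_mono) (use assms in auto)
  also have "\<dots> = multilinear_ext U h y"
    by (intro multilinear_ext_cong) (auto simp: override_on_def)
  finally show ?thesis .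
qed

lemma multilinear_ext_indicator:
  assumes "finite U" "A \<subseteq> U"
  shows "multilinear_ext U h (indicator A) = h A"
proof -
  have "h S * (\<Prod>i\<in>S. indicator A i) * (\<Prod>i\<in>U - S. 1 - indicator A i) = (if S = A then h S else 0)"
    if "S \<subseteq> U" for S
  proof (cases "S = A")
    case False
    have fin: "finite S" "finite (U - S)" using that assms finite_subset by auto
    from False consider i where "i \<in> S - A" | i where "i \<in> A - S" by blast
    then show ?thesis
    proof cases
      case 1
      then have "i \<in> S" "indicator A i = (0::real)" by auto
      then have "(\<Prod>i\<in>S. indicator A i) = (0::real)" using fin by (intro prod_zero) auto
      then show ?thesis using False by simp
    next
      case 2
      then have "i \<in> U - S" "1 - indicator A i = (0::real)" using assms by auto
      then have "(\<Prod>i\<in>U - S. 1 - indicator A i) = (0::real)" using fin by (intro prod_zero) auto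
      then show ?thesis using False by simp
    qed
  qed (auto intro!: prod.neutral)
  then show ?thesis
    unfolding multilinear_ext_def using assms by (simp add: sum.delta)
qed

lemma continuous_on_multilinear_ext [continuous_intros]:
  assumes "\<And>i. continuous_on X (\<lambda>s. x s i)"
  shows "continuous_on X (\<lambda>s. multilinear_ext U h (x s))"
  unfolding multilinear_ext_def by (intro continuous_intros assms)

lemma grad_at_eq:
  assumes "finite U" "i \<in> U"
  shows "grad_at U f t A i = multilinear_ext U (\<lambda>S. f (insert i S) - f (S - {i})) (\<lambda>u. t * indicator A u)"
  unfolding grad_at_def by (rule partial_deriv_multilinear_ext[OF assms])

lemma continuous_on_grad_at:
  assumes "finite U" "i \<in> U"
  shows "continuous_on X (\<lambda>t. grad_at U f t A i)"
  unfolding grad_at_eq[OF assms] by (intro continuous_intros)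

section \<open>Gradient inequalities for monotone submodular functions\<close>

locale monotone_submodular =
  fixes U :: "'a set" and f :: "'a set \<Rightarrow> real"
  assumes finite_U: "finite U"
    and f_nonneg: "X \<subseteq> U \<Longrightarrow> 0 \<le> f X"
    and f_mono: "monotone_set_fun U f"
    and f_submodular: "submodular U f"
begin

abbreviation F where "F \<equiv> multilinear_ext U f"
abbreviation "unit_point x \<equiv> \<forall>i\<in>U. 0 \<le> x i \<and> x i \<le> (1::real)"

lemma f_le: "S \<subseteq> T \<Longrightarrow> T \<subseteq> U \<Longrightarrow> f S \<le> f T"
  using f_mono by (auto simp: monotone_set_fun_def)

text \<open>Removing \<open>i\<close> from both sets first reduces to the case of \<open>i\<close>
  outside, so sets containing \<open>i\<close> are covered too. This is the form of the set function
  whose extension is \<open>partial_deriv F i\<close>.\<close>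

lemma marginal_antimono:
  assumes "S \<subseteq> T" "T \<subseteq> U" "i \<in> U"
  shows "f (insert i T) - f (T - {i}) \<le> f (insert i S) - f (S - {i})"
proof -
  have "S - {i} \<subseteq> T - {i}" "T - {i} \<subseteq> U" "i \<in> U - (T - {i})" using assms by auto
  then have "f (insert i (S - {i})) - f (S - {i}) \<ge> f (insert i (T - {i})) - f (T - {i})"
    using f_submodular unfolding submodular_def by blast
  then show ?thesis by simp
qed

text \<open>The elements of \<open>Q\<close> join \<open>R\<close> one by one, and each gain is at
  most the marginal with respect to \<open>R\<close> alone.\<close>

lemma sum_marginal_ge:
  assumes "R \<subseteq> U" "Q \<subseteq> U"
  shows "f Q - f R \<le> (\<Sum>i\<in>Q. f (insert i R) - f (R - {i}))"
proof -
  have fin: "finite Q" using assms finite_U finite_subset by auto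
  have "f (R \<union> Q) - f R \<le> (\<Sum>i\<in>Q. f (insert i R) - f (R - {i}))"
    using fin assms(2)
  proof (induction Q rule: finite_induct)
    case (insert q Q)
    have "f (insert q (R \<union> Q)) - f ((R \<union> Q) - {q}) \<le> f (insert q R) - f (R - {q})"
      using insert assms by (intro marginal_antimono) auto
    \<comment> \<open>If \<open>q\<close> already lies in \<open>R\<close>, the marginal refers to a
      set lacking \<open>q\<close>, and monotonicity is what compares it with
      \<open>R \<union> Q\<close>.\<close>
    moreover have "f ((R \<union> Q) - {q}) \<le> f (R \<union> Q)" using insert assms by (intro f_le) auto
    ultimately show ?case using insert by (auto simp: Un_insert_right)
  qed simp
  moreover have "f Q \<le> f (R \<union> Q)" using assms by (intro f_le) auto
  ultimately show ?thesis by simp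
qed

lemma F_bounds:
  assumes "unit_point x"
  shows "0 \<le> F x" "F x \<le> f U"
proof -
  have "multilinear_ext U (\<lambda>_. 0) x \<le> F x"
    using assms f_nonneg by (intro multilinear_ext_mono[OF finite_U]) auto
  moreover have "F x \<le> multilinear_ext U (\<lambda>_. f U) x"
    using assms f_le by (intro multilinear_ext_mono[OF finite_U]) auto
  ultimately show "0 \<le> F x" "F x \<le> f U"
    by (simp_all add: multilinear_ext_const[OF finite_U])
qed

lemma partial_bounds:
  assumes "i \<in> U" "unit_point x"
  shows "0 \<le> partial_deriv F i x" "partial_deriv F i x \<le> f U"
proof -
  note eq = partial_deriv_multilinear_ext[OF finite_U assms(1)]
  have "multilinear_ext U (\<lambda>S. 0) x \<le> partial_deriv F i x"
    unfolding eq
  proof (intro multilinear_ext_mono[OF finite_U])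
    fix S assume "S \<subseteq> U"
    then show "0 \<le> f (insert i S) - f (S - {i})"
      using assms f_le[of "S - {i}" "insert i S"] by auto
  qed (use assms in auto)
  moreover have "partial_deriv F i x \<le> multilinear_ext U (\<lambda>S. f U) x"
    unfolding eq
  proof (intro multilinear_ext_mono[OF finite_U])
    fix S assume "S \<subseteq> U"
    then show "f (insert i S) - f (S - {i}) \<le> f U"
      using assms f_le[of "insert i S" U] f_nonneg[of "S - {i}"] by (auto simp: subset_iff)
  qed (use assms in auto)
  ultimately show "0 \<le> partial_deriv F i x" "partial_deriv F i x \<le> f U"
    by (simp_all add: multilinear_ext_const[OF finite_U])
qed

lemma partial_antimono:
  assumes "i \<in> U" "\<And>j. j \<in> U \<Longrightarrow> 0 \<le> x j \<and> x j \<le> y j \<and> y j \<le> 1"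
  shows "partial_deriv F i y \<le> partial_deriv F i x"
proof -
  note eq = partial_deriv_multilinear_ext[OF finite_U assms(1)]
  have "multilinear_ext U (\<lambda>S. (-1) * (f (insert i S) - f (S - {i}))) x \<le>
    multilinear_ext U (\<lambda>S. (-1) * (f (insert i S) - f (S - {i}))) y"
  proof (intro multilinear_ext_mono_point finite_U)
    show "(-1) * (f (insert i S) - f (S - {i})) \<le> (-1) * (f (insert i T) - f (T - {i}))"
      if "S \<subseteq> T" "T \<subseteq> U" for S T
      using marginal_antimono[OF that assms(1)] by simp
  qed (use assms in auto)
  then show ?thesis unfolding eq multilinear_ext_cmult by simp
qed

text \<open>Concavity in nonnegative directions: on the path that raises one coordinate at a time
  every hybrid point lies below \<open>y\<close>, so each slope is at least the partial derivative
  at \<open>y\<close>.\<close>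

lemma F_diff_ge:
  assumes x: "\<And>j. j \<in> U \<Longrightarrow> 0 \<le> x j \<and> x j \<le> y j \<and> y j \<le> 1"
  shows "F y - F x \<ge> (\<Sum>i\<in>U. (y i - x i) * partial_deriv F i y)"
proof -
  have "F (override_on x y B) - F x \<ge> (\<Sum>i\<in>B. (y i - x i) * partial_deriv F i y)" if "B \<subseteq> U" for B
  proof -
    have "finite B" using that finite_U finite_subset by blast
    then show ?thesis using that
    proof (induction B rule: finite_induct)
      case (insert b B)
      let ?z = "override_on x y B"
      have b: "b \<in> U" "?z b = x b" using insert by (auto simp: override_on_def)
      have "partial_deriv F b y \<le> partial_deriv F b ?z"
      proof (intro partial_antimono b)
        show "0 \<le> ?z j \<and> ?z j \<le> y j \<and> y j \<le> 1" if "j \<in> U" for j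
          using x[OF that] by (auto simp: override_on_def)
      qed
      then have "(y b - x b) * partial_deriv F b y \<le> (y b - x b) * partial_deriv F b ?z"
        using x[OF b(1)] by (intro mult_left_mono) auto
      also have "\<dots> = F (?z(b := y b)) - F ?z"
        using multilinear_ext_upd_diff[OF finite_U b(1), of f ?z "y b"] b by simp
      also have "?z(b := y b) = override_on x y (insert b B)"
        by (auto simp: override_on_def)
      finally show ?case using insert by simp
    qed simp
  qed
  from this[of U] have "F (override_on x y U) - F x \<ge> (\<Sum>i\<in>U. (y i - x i) * partial_deriv F i y)"
    by simp
  also have "F (override_on x y U) = F y"
    by (intro multilinear_ext_cong) (auto simp: override_on_def)
  finally show ?thesis .
qed

text \<open>\<open>F x\<close> is the mean of \<open>f R\<close> over a random \<open>R\<close>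
  containing each \<open>i\<close> independently with probability \<open>x i\<close>; the claim
  averages \<open>sum_marginal_ge\<close> over this \<open>R\<close>.\<close>

lemma sum_partial_ge:
  assumes "unit_point x" "Q \<subseteq> U"
  shows "f Q - F x \<le> (\<Sum>i\<in>Q. partial_deriv F i x)"
proof -
  have "f Q - F x = multilinear_ext U (\<lambda>R. f Q - f R) x"
    by (simp add: multilinear_ext_diff multilinear_ext_const[OF finite_U])
  also have "\<dots> \<le> multilinear_ext U (\<lambda>R. \<Sum>i\<in>Q. f (insert i R) - f (R - {i})) x"
    using assms by (intro multilinear_ext_mono finite_U sum_marginal_ge) auto
  also have "\<dots> = (\<Sum>i\<in>Q. partial_deriv F i x)"
    unfolding multilinear_ext_sum using assms
    by (intro sum.cong refl) (auto simp: partial_deriv_multilinear_ext[OF finite_U])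
  finally show ?thesis .
qed

text \<open>For \<open>A \<subseteq> U\<close> and \<open>t\<close> in \<open>[0, 1]\<close>, this
  is the mean of \<open>f\<close> over a random subset of \<open>A\<close> that keeps each element
  independently with probability \<open>t\<close>. It is the integrand of the potential.\<close>

definition scaled :: "real \<Rightarrow> 'a set \<Rightarrow> real" where
  "scaled t A = F (\<lambda>u. t * indicator A u)"

lemma unit_scaled: "0 \<le> t \<Longrightarrow> t \<le> 1 \<Longrightarrow> unit_point (\<lambda>u. t * indicator A u)"
  by (auto simp: indicator_def)

lemma scaled_bounds: "0 \<le> t \<Longrightarrow> t \<le> 1 \<Longrightarrow> 0 \<le> scaled t A \<and> scaled t A \<le> f U"
  unfolding scaled_def using F_bounds[OF unit_scaled] by blast

lemma scaled_one: "A \<subseteq> U \<Longrightarrow> scaled 1 A = f A"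
  using multilinear_ext_indicator[OF finite_U] by (simp add: scaled_def)

lemma scaled_mono: "0 \<le> s \<Longrightarrow> s \<le> t \<Longrightarrow> t \<le> 1 \<Longrightarrow> scaled s A \<le> scaled t A"
  unfolding scaled_def
  by (intro multilinear_ext_mono_point finite_U f_le) (auto simp: indicator_def)

lemma grad_bounds:
  "i \<in> U \<Longrightarrow> 0 \<le> t \<Longrightarrow> t \<le> 1 \<Longrightarrow> 0 \<le> grad_at U f t A i \<and> grad_at U f t A i \<le> f U"
  unfolding grad_at_def using partial_bounds[OF _ unit_scaled] by blast

lemma scaled_diff_ge:
  assumes "0 \<le> s" "s \<le> t" "t \<le> 1" "A \<subseteq> U"
  shows "scaled t A - scaled s A \<ge> (t - s) * (\<Sum>a\<in>A. grad_at U f t A a)"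
proof -
  have "scaled t A - scaled s A \<ge>
      (\<Sum>i\<in>U. (t * indicator A i - s * indicator A i) * grad_at U f t A i)"
    unfolding scaled_def grad_at_def using assms by (intro F_diff_ge) (auto simp: indicator_def)
  also have "(\<Sum>i\<in>U. (t * indicator A i - s * indicator A i) * grad_at U f t A i) =
      (\<Sum>i\<in>A. (t - s) * grad_at U f t A i)"
    using assms finite_U by (intro sum.mono_neutral_cong_right) auto
  finally show ?thesis by (simp add: sum_distrib_left)
qed

lemma scaled_gap:
  assumes "0 \<le> t" "t \<le> 1" "Q \<subseteq> U"
  shows "f Q - scaled t A \<le> (\<Sum>i\<in>Q. grad_at U f t A i)"
  unfolding scaled_def grad_at_def using assms by (intro sum_partial_ge unit_scaled) auto

text \<open>Lowering coordinate \<open>i\<close> to \<open>0\<close> costs exactly \<open>t\<close>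
  times its partial derivative, since \<open>F\<close> is affine there. The resulting
  \<open>z\<close> lies below \<open>x\<close>, so raising \<open>j\<close> from \<open>0\<close> to
  \<open>t\<close> gains at least \<open>t\<close> times the derivative at \<open>x\<close>. The
  hypothesis on \<open>j\<close> ensures \<open>z j = 0\<close> and admits
  \<open>j = i\<close>.\<close>

lemma scaled_swap_ge:
  assumes t: "0 \<le> t" "t \<le> 1" and ij: "i \<in> A" "j \<in> U" "j \<notin> A - {i}" and A: "A \<subseteq> U"
  shows "scaled t (apply_swap A (i, j)) - scaled t A \<ge> t * (grad_at U f t A j - grad_at U f t A i)"
proof -
  define x where "x = (\<lambda>u. t * indicator A u :: real)"
  define z where "z = x(i := 0)"
  have i: "i \<in> U" using ij A by auto
  have xi: "x i = t" and zj: "z j = 0" using ij by (auto simp: x_def z_def)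
  have zx: "0 \<le> z u \<and> z u \<le> x u \<and> x u \<le> 1" for u
    using t by (auto simp: x_def z_def indicator_def)
  have "F z - F x = - t * partial_deriv F i x"
    using multilinear_ext_upd_diff[OF finite_U i, of f x 0] by (simp add: xi z_def)
  moreover have "F (z(j := t)) - F z = t * partial_deriv F j z"
    using multilinear_ext_upd_diff[OF finite_U ij(2), of f z t] by (simp add: zj)
  moreover have "t * partial_deriv F j x \<le> t * partial_deriv F j z"
    using t zx ij by (intro mult_left_mono partial_antimono) auto
  moreover have "z(j := t) = (\<lambda>u. t * indicator (apply_swap A (i, j)) u)"
    by (auto simp: z_def x_def apply_swap_def indicator_def fun_eq_iff)
  ultimately show ?thesis
    unfolding scaled_def grad_at_def x_def[symmetric] by (simp add: right_diff_distrib)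
qed

end

section \<open>Event times and independence of increments\<close>

lemma initial_segment_eq_lessThan:
  fixes C :: "nat set"
  assumes fin: "finite C" and down: "\<And>m n. n \<in> C \<Longrightarrow> m \<le> n \<Longrightarrow> m \<in> C"
  shows "C = {..<card C}"
proof (cases "C = {}")
  case False
  then have "C = {..Max C}"
    using Max_ge[OF fin] down[OF Max_in[OF fin False]] by auto
  then show ?thesis by (metis card_atMost lessThan_Suc_atMost)
qed simp

locale poisson_run =
  fixes M :: "'w measure" and rate :: "real \<Rightarrow> real" and \<epsilon> :: real and N :: "real \<Rightarrow> 'w \<Rightarrow> nat"
  assumes poisson: "nonhom_poisson_process M rate \<epsilon> 1 N"
    and eps_le: "\<epsilon> \<le> 1"
begin

sublocale prob_space M
  using poisson by (simp add: nonhom_poisson_process_def)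

lemma N_measurable: "t \<in> {\<epsilon>..1} \<Longrightarrow> N t \<in> M \<rightarrow>\<^sub>M count_space UNIV"
  using poisson by (simp add: nonhom_poisson_process_def)

lemma N_start: "\<omega> \<in> space M \<Longrightarrow> N \<epsilon> \<omega> = 0"
  using poisson by (simp add: nonhom_poisson_process_def)

lemma N_mono: "\<omega> \<in> space M \<Longrightarrow> \<epsilon> \<le> s \<Longrightarrow> s \<le> t \<Longrightarrow> t \<le> 1 \<Longrightarrow> N s \<omega> \<le> N t \<omega>"
  using poisson by (auto simp: nonhom_poisson_process_def mono_on_def)

lemma N_right_continuous:
  assumes "\<omega> \<in> space M" "t \<in> {\<epsilon>..1}"
  shows "\<forall>\<^sub>F s in at t within {t..1}. N s \<omega> = N t \<omega>"
proof -
  have "continuous (at t within {t..1}) (\<lambda>s. N s \<omega>)"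
    using poisson assms by (simp add: nonhom_poisson_process_def)
  then show ?thesis by (simp add: continuous_within tendsto_discrete)
qed

lemma N_increments_indep:
  assumes "\<And>i. i \<le> n \<Longrightarrow> s i \<in> {\<epsilon>..1}" "\<And>i. i < n \<Longrightarrow> s i \<le> s (Suc i)"
  shows "indep_vars (\<lambda>_. count_space UNIV) (\<lambda>i \<omega>. N (s (Suc i)) \<omega> - N (s i) \<omega>) {..<n::nat}"
  using poisson assms by (simp add: nonhom_poisson_process_def)

lemma N_increment_prob:
  "s \<in> {\<epsilon>..1} \<Longrightarrow> t \<in> {s..1} \<Longrightarrow> prob {\<omega> \<in> space M. N t \<omega> - N s \<omega> = n}
    = integral {s..t} rate ^ n / fact n * exp (- integral {s..t} rate)"
  using poisson by (simp add: nonhom_poisson_process_def)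

text \<open>A right-continuous integer-valued path is constant just after \<open>t\<close>, so the
  infimum in \<open>event_time\<close> is attained; \<open>n < N 1 \<omega>\<close> keeps it from
  being an infimum over the empty set.\<close>

lemma event_time_le_iff:
  assumes \<omega>: "\<omega> \<in> space M" and n: "n < N 1 \<omega>" and t: "t \<in> {\<epsilon>..1}"
  shows "event_time \<epsilon> N n \<omega> \<le> t \<longleftrightarrow> n < N t \<omega>"
proof
  let ?S = "{t \<in> {\<epsilon>..1}. n < N t \<omega>}"
  have bdd: "bdd_below ?S" by (rule bdd_belowI[of _ \<epsilon>]) auto
  show "event_time \<epsilon> N n \<omega> \<le> t" if "n < N t \<omega>"
    unfolding event_time_def using that t by (intro cInf_lower bdd) auto
  show "n < N t \<omega>" if le: "event_time \<epsilon> N n \<omega> \<le> t"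
  proof (rule ccontr)
    assume *: "\<not> n < N t \<omega>"
    then have "t < 1" using n t by (cases "t = 1") auto
    from N_right_continuous[OF \<omega> t] obtain e where e: "e > t"
      "\<And>s. s \<in> {t..1} \<Longrightarrow> s \<noteq> t \<Longrightarrow> s < e \<Longrightarrow> N s \<omega> = N t \<omega>"
    proof -
      assume that: "\<And>e. t < e \<Longrightarrow> (\<And>s. s \<in> {t..1} \<Longrightarrow> s \<noteq> t \<Longrightarrow> s < e \<Longrightarrow> N s \<omega> = N t \<omega>) \<Longrightarrow> thesis"
      from N_right_continuous[OF \<omega> t] obtain d where d: "d > 0"
        "\<And>s. s \<in> {t..1} \<Longrightarrow> s \<noteq> t \<Longrightarrow> dist s t < d \<Longrightarrow> N s \<omega> = N t \<omega>"
        unfolding eventually_at by auto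
      show thesis by (rule that[of "t + d"]) (use d in \<open>auto simp: dist_real_def\<close>)
    qed
    have "min e 1 \<le> s" if s: "s \<in> ?S" for s
    proof (rule ccontr)
      assume "\<not> min e 1 \<le> s"
      then have "s < e" "s < 1" by auto
      have "N s \<omega> \<le> N t \<omega>"
      proof (cases "s \<le> t")
        case True then show ?thesis using N_mono[OF \<omega>] s t by auto
      next
        case False then show ?thesis using e(2)[of s] \<open>s < e\<close> \<open>s < 1\<close> by auto
      qed
      then show False using s * by auto
    qed
    then have "min e 1 \<le> event_time \<epsilon> N n \<omega>"
      unfolding event_time_def using n eps_le by (intro cInf_greatest) auto
    then show False using le e \<open>t < 1\<close> by auto
  qed
qed

lemma event_time_bounds:
  assumes "\<omega> \<in> space M" "n < N 1 \<omega>"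
  shows "event_time \<epsilon> N n \<omega> \<in> {\<epsilon>..1}"
proof -
  have "\<epsilon> \<le> event_time \<epsilon> N n \<omega>"
    unfolding event_time_def using assms eps_le by (intro cInf_greatest) auto
  moreover have "event_time \<epsilon> N n \<omega> \<le> 1"
    using event_time_le_iff[OF assms, of 1] assms eps_le by auto
  ultimately show ?thesis by auto
qed

lemma event_time_mono:
  assumes \<omega>: "\<omega> \<in> space M" and n: "n < N 1 \<omega>" and m: "m \<le> n"
  shows "event_time \<epsilon> N m \<omega> \<le> event_time \<epsilon> N n \<omega>"
proof -
  have "n < N (event_time \<epsilon> N n \<omega>) \<omega>"
    using event_time_le_iff[OF \<omega> n event_time_bounds[OF \<omega> n]] by simp
  then show ?thesis
    using event_time_le_iff[OF \<omega> _ event_time_bounds[OF \<omega> n], of m] m n by auto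
qed

text \<open>Event times are nondecreasing in the index, so the events before time \<open>1\<close>
  form an initial segment, and an index belongs to it iff it is below the number of its
  elements.\<close>

lemma num_calls_iff:
  assumes \<omega>: "\<omega> \<in> space M"
  shows "n < num_calls \<epsilon> N \<omega> \<longleftrightarrow> n < N 1 \<omega> \<and> event_time \<epsilon> N n \<omega> < 1"
proof -
  let ?C = "{n. n < N 1 \<omega> \<and> event_time \<epsilon> N n \<omega> < 1}"
  have down: "m \<in> ?C" if "n \<in> ?C" "m \<le> n" for m n
    using event_time_mono[OF \<omega>, of n m] that by auto
  have fin: "finite ?C" by (rule finite_subset[of _ "{..<N 1 \<omega>}"]) auto
  have "?C = {..<card ?C}" by (rule initial_segment_eq_lessThan[OF fin down])
  then show ?thesis unfolding num_calls_def by blast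
qed

text \<open>Where \<open>N t \<omega> \<le> n\<close>, the event time is replaced by \<open>1\<close>; it is then determined by the
  counts up to time \<open>t\<close>.\<close>

lemma measurable_event_time:
  assumes M': "space M' = space M" "\<And>s. s \<in> {\<epsilon>..t} \<Longrightarrow> N s \<in> M' \<rightarrow>\<^sub>M count_space UNIV"
    and t: "t \<in> {\<epsilon>..1}"
  shows "(\<lambda>\<omega>. if n < N t \<omega> then event_time \<epsilon> N n \<omega> else 1) \<in> borel_measurable M'"
proof (rule borel_measurable_iff_le[THEN iffD2], rule allI)
  fix c :: real
  let ?T = "\<lambda>\<omega>. if n < N t \<omega> then event_time \<epsilon> N n \<omega> else 1"
  have N1: "n < N 1 \<omega>" if "\<omega> \<in> space M" "n < N t \<omega>" for \<omega>
    using N_mono[OF that(1), of t 1] t that by auto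
  have T: "?T \<omega> \<in> {\<epsilon>..1}" if "\<omega> \<in> space M" for \<omega>
    using event_time_bounds[OF that N1[OF that]] eps_le by auto
  consider "c < \<epsilon>" | "1 \<le> c" | "c \<in> {\<epsilon>..<1}" by force
  then show "{\<omega> \<in> space M'. ?T \<omega> \<le> c} \<in> sets M'"
  proof cases
    case 1
    then have "{\<omega> \<in> space M'. ?T \<omega> \<le> c} = {}" using T M'(1) by fastforce
    then show ?thesis by (metis sets.empty_sets)
  next
    case 2
    then have "{\<omega> \<in> space M'. ?T \<omega> \<le> c} = space M'" using T M'(1) by fastforce
    then show ?thesis by (metis sets.top)
  next
    case 3
    \<comment> \<open>Only counts up to \<open>t\<close> may be used, hence \<open>min c t\<close>.
      As \<open>c < 1\<close>, the default value \<open>1\<close> never satisfies the bound, so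
      satisfying it means being counted both by \<open>t\<close> and by \<open>c\<close>.\<close>
    have "?T \<omega> \<le> c \<longleftrightarrow> n < N (min c t) \<omega>" if \<omega>: "\<omega> \<in> space M" for \<omega>
    proof (cases "n < N t \<omega>")
      case True
      then show ?thesis using event_time_le_iff[OF \<omega> N1[OF \<omega> True], of c] 3 N_mono[OF \<omega>, of t c] t
        by (auto simp: min_def)
    next
      case False
      then show ?thesis using N_mono[OF \<omega>, of "min c t" t] 3 t by (auto simp: min_def)
    qed
    then have "{\<omega> \<in> space M'. ?T \<omega> \<le> c} = N (min c t) -` {n<..} \<inter> space M'"
      unfolding M'(1) by blast
    also have "\<dots> \<in> sets M'" by (rule measurable_sets[OF M'(2)]) (use 3 t in auto)
    finally show ?thesis .
  qed
qed

section \<open>The natural filtration of the event process and its independence from later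
  increments\<close>

definition past :: "real \<Rightarrow> 'w measure" where
  "past t = sigma (space M) {N s -` X \<inter> space M | s X. s \<in> {\<epsilon>..t}}"

lemma space_past [simp]: "space (past t) = space M"
  unfolding past_def by (rule space_measure_of) auto

lemma sets_past: "sets (past t) = sigma_sets (space M) {N s -` X \<inter> space M | s X. s \<in> {\<epsilon>..t}}"
  unfolding past_def by (rule sets_measure_of) auto

lemma measurable_past: "s \<in> {\<epsilon>..t} \<Longrightarrow> N s \<in> past t \<rightarrow>\<^sub>M count_space UNIV"
  by (rule measurableI) (auto simp: sets_past)

lemma past_events: "t \<le> 1 \<Longrightarrow> sets (past t) \<subseteq> events"
  unfolding sets_past by (intro sets.sigma_sets_subset) (auto intro!: measurable_sets[OF N_measurable])

lemma past_measurable: "t \<le> 1 \<Longrightarrow> Y \<in> past t \<rightarrow>\<^sub>M L \<Longrightarrow> Y \<in> M \<rightarrow>\<^sub>M L"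
  using past_events by (auto simp: measurable_def)

text \<open>The events that depend on the counts at finitely many times form a generating
  \<open>\<pi>\<close>-system of the past.\<close>

definition cylinders :: "real \<Rightarrow> 'w set set" where
  "cylinders t = {{\<omega> \<in> space M. Q (restrict (\<lambda>s. N s \<omega>) J)} | Q J. finite J \<and> J \<subseteq> {\<epsilon>..t}}"

lemma cylindersI:
  "finite J \<Longrightarrow> J \<subseteq> {\<epsilon>..t} \<Longrightarrow> C = {\<omega> \<in> space M. Q (restrict (\<lambda>s. N s \<omega>) J)} \<Longrightarrow> C \<in> cylinders t"
  unfolding cylinders_def by (intro CollectI exI conjI)

lemma Int_stable_cylinders: "Int_stable (cylinders t)"
proof (rule Int_stableI)
  fix A B assume "A \<in> cylinders t" "B \<in> cylinders t"
  then obtain Q J Q' J' where *: "finite J" "J \<subseteq> {\<epsilon>..t}" "A = {\<omega> \<in> space M. Q (restrict (\<lambda>s. N s \<omega>) J)}"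
    "finite J'" "J' \<subseteq> {\<epsilon>..t}" "B = {\<omega> \<in> space M. Q' (restrict (\<lambda>s. N s \<omega>) J')}"
    unfolding cylinders_def by blast
  have r: "restrict (restrict (\<lambda>s. N s \<omega>) (J \<union> J')) J = restrict (\<lambda>s. N s \<omega>) J"
     "restrict (restrict (\<lambda>s. N s \<omega>) (J \<union> J')) J' = restrict (\<lambda>s. N s \<omega>) J'" for \<omega>
    by (auto simp: restrict_def)
  show "A \<inter> B \<in> cylinders t"
    by (rule cylindersI[where J="J \<union> J'" and Q="\<lambda>x. Q (restrict x J) \<and> Q' (restrict x J')"])
      (use * in \<open>auto simp: r\<close>)
qed

text \<open>The Poisson axioms speak of increments over consecutive intervals. Counts at finitely
  many times up to \<open>t\<close> are partial sums of such increments, and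
  \<open>N u - N t\<close> is one further increment of the same grid.\<close>

lemma cylinder_increment_indep:
  assumes t: "t \<in> {\<epsilon>..1}" "u \<in> {t..1}" and C: "C \<in> cylinders t"
  shows "C \<in> events" "prob (C \<inter> {\<omega> \<in> space M. N u \<omega> - N t \<omega> = d})
    = prob C * prob {\<omega> \<in> space M. N u \<omega> - N t \<omega> = d}"
proof -
  obtain Q J where C_eq: "C = {\<omega> \<in> space M. Q (restrict (\<lambda>s. N s \<omega>) J)}"
    and J: "finite J" "J \<subseteq> {\<epsilon>..t}" using C unfolding cylinders_def by blast
  \<comment> \<open>Including \<open>\<epsilon>\<close> makes each count a full sum of increments,
    as \<open>N \<epsilon> = 0\<close>; including \<open>t\<close> makes the last step of the grid
    run from \<open>t\<close> to \<open>u\<close>.\<close>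
  define xs where "xs = sorted_list_of_set (insert \<epsilon> (insert t J))"
  define n where "n = length xs"
  define s where "s i = (if i < n then xs ! i else u)" for i
  have xs: "set xs = insert \<epsilon> (insert t J)" "sorted xs"
    unfolding xs_def using sorted_list_of_set.sorted_sorted_key_list_of_set[of "insert \<epsilon> (insert t J)"]
    by (simp_all add: J(1) del: sorted_list_of_set_insert_remove)
  have "xs \<noteq> []" using xs(1) by auto
  then have n0: "0 < n" by (simp add: n_def)
  have mem: "xs ! i \<in> {\<epsilon>..t}" if "i < n" for i
    using nth_mem[of i xs] that xs J t unfolding n_def by auto
  have s_mem: "s i \<in> {\<epsilon>..1}" for i using mem[of i] t by (auto simp: s_def)
  have s_mono: "s i \<le> s (Suc i)" for i
    using mem[of i] t sorted_nth_mono[OF xs(2), of i "Suc i"] by (auto simp: s_def n_def)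
  have s_0: "s 0 = \<epsilon>"
  proof -
    have "\<epsilon> \<in> set xs" using xs(1) by simp
    then obtain i where "i < n" "xs ! i = \<epsilon>" unfolding n_def in_set_conv_nth by blast
    then have "xs ! 0 \<le> \<epsilon>" using sorted_nth_mono[OF xs(2), of 0 i] by (auto simp: n_def)
    then show ?thesis using mem[OF n0] n0 by (auto simp: s_def)
  qed
  have s_last: "s (n - 1) = t"
  proof -
    have "t \<in> set xs" using xs(1) by simp
    then obtain i where "i < n" "xs ! i = t" unfolding n_def in_set_conv_nth by blast
    then have "t \<le> xs ! (n - 1)" using sorted_nth_mono[OF xs(2), of i "n - 1"] by (auto simp: n_def)
    then show ?thesis using mem[of "n - 1"] n0 by (auto simp: s_def)
  qed
  have s_n: "s n = u" by (simp add: s_def)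
  define D where "D i \<omega> = N (s (Suc i)) \<omega> - N (s i) \<omega>" for i \<omega>
  have ind: "indep_vars (\<lambda>_. count_space UNIV) D {..<n}"
    unfolding D_def using N_increments_indep[of n s] s_mem s_mono by simp
  have N_sum: "N (s i) \<omega> = (\<Sum>j<i. D j \<omega>)" if "\<omega> \<in> space M" for i \<omega>
  proof (induction i)
    case 0 show ?case using s_0 N_start that by simp
  next
    case (Suc i)
    have "N (s i) \<omega> \<le> N (s (Suc i)) \<omega>" using N_mono[OF that] s_mem[of i] s_mem[of "Suc i"] s_mono by auto
    then show ?case using Suc by (simp add: D_def)
  qed
  have "\<exists>i<n. r = s i" if "r \<in> J" for r
  proof -
    have "r \<in> set xs" using that xs(1) by simp
    then obtain i where "i < n" "xs ! i = r" unfolding n_def in_set_conv_nth by blast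
    then show ?thesis by (intro exI[of _ i]) (simp add: s_def)
  qed
  then obtain p where p: "\<And>r. r \<in> J \<Longrightarrow> p r < n \<and> r = s (p r)" by metis
  define Q' where "Q' x = Q (restrict (\<lambda>r. \<Sum>j<p r. x j) J)" for x :: "nat \<Rightarrow> nat"
  have Q': "Q (restrict (\<lambda>r. N r \<omega>) J) = Q' (restrict (\<lambda>i. D i \<omega>) {..<n - 1})" if \<omega>: "\<omega> \<in> space M" for \<omega>
  proof -
    have "N r \<omega> = (\<Sum>j<p r. restrict (\<lambda>i. D i \<omega>) {..<n - 1} j)" if "r \<in> J" for r
    proof -
      have "N r \<omega> = N (s (p r)) \<omega>" using p[OF that] by metis
      also have "\<dots> = (\<Sum>j<p r. restrict (\<lambda>i. D i \<omega>) {..<n - 1} j)"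
        unfolding N_sum[OF \<omega>] using p[OF that] by (intro sum.cong) auto
      finally show ?thesis .
    qed
    then have "restrict (\<lambda>r. N r \<omega>) J = restrict (\<lambda>r. \<Sum>j<p r. restrict (\<lambda>i. D i \<omega>) {..<n - 1} j) J"
      by (intro restrict_ext) simp
    then show ?thesis by (simp add: Q'_def)
  qed
  \<comment> \<open>The increments with index below \<open>n - 1\<close> determine the counts up to
    \<open>t\<close>; increment \<open>n - 1\<close> is \<open>N u - N t\<close>.\<close>
  have "{n - 1} \<subseteq> {..<n}" "{..<n - 1} \<subseteq> {..<n}" using n0 by auto
  then have "indep_var (PiM {..<n - 1} (\<lambda>_. count_space UNIV)) (\<lambda>\<omega>. restrict (\<lambda>i. D i \<omega>) {..<n - 1})
      (PiM {n - 1} (\<lambda>_. count_space UNIV)) (\<lambda>\<omega>. restrict (\<lambda>i. D i \<omega>) {n - 1})"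
    by (intro indep_var_restrict[OF ind]) auto
  \<comment> \<open>A finite product of countable discrete spaces is discrete, so the arbitrary
    predicate \<open>Q'\<close> defines a measurable set.\<close>
  then have ind2: "indep_var (count_space (PiE {..<n - 1} (\<lambda>_. UNIV))) (\<lambda>\<omega>. restrict (\<lambda>i. D i \<omega>) {..<n - 1})
      (count_space (PiE {n - 1} (\<lambda>_. UNIV))) (\<lambda>\<omega>. restrict (\<lambda>i. D i \<omega>) {n - 1})"
    by (simp add: count_space_PiM_finite)
  let ?X1 = "{x \<in> PiE {..<n - 1} (\<lambda>_. UNIV). Q' x}" and ?X2 = "{x \<in> PiE {n - 1} (\<lambda>_. UNIV). x (n - 1) = d}"
  have C1: "C = (\<lambda>\<omega>. restrict (\<lambda>i. D i \<omega>) {..<n - 1}) -` ?X1 \<inter> space M"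
    using Q' by (auto simp: C_eq)
  have C2: "{\<omega> \<in> space M. N u \<omega> - N t \<omega> = d} = (\<lambda>\<omega>. restrict (\<lambda>i. D i \<omega>) {n - 1}) -` ?X2 \<inter> space M"
    using n0 s_n s_last by (auto simp: D_def)
  show "C \<in> events"
    unfolding C1 using ind2 by (intro measurable_sets[of _ _ "count_space (PiE {..<n - 1} (\<lambda>_. UNIV))"])
      (auto dest: indep_var_rv1)
  have "prob (C \<inter> {\<omega> \<in> space M. N u \<omega> - N t \<omega> = d}) =
    prob ((\<lambda>\<omega>. (restrict (\<lambda>i. D i \<omega>) {..<n - 1}, restrict (\<lambda>i. D i \<omega>) {n - 1})) -` (?X1 \<times> ?X2) \<inter> space M)"
    unfolding C1 C2 by (intro arg_cong[where f=prob]) auto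
  also have "\<dots> = prob C * prob {\<omega> \<in> space M. N u \<omega> - N t \<omega> = d}"
    unfolding C1 C2 by (rule indep_varD[OF ind2]) auto
  finally show "prob (C \<inter> {\<omega> \<in> space M. N u \<omega> - N t \<omega> = d})
    = prob C * prob {\<omega> \<in> space M. N u \<omega> - N t \<omega> = d}" .
qed

text \<open>Independence passes from the \<pi>-system \<open>cylinders t\<close> to the
  \<sigma>-algebra it generates, and from there to expectations of bounded functions.\<close>

lemma past_increment_indep:
  assumes t: "t \<in> {\<epsilon>..1}" "u \<in> {t..1}"
    and Y: "Y \<in> borel_measurable (past t)" and bnd: "\<And>\<omega>. \<omega> \<in> space M \<Longrightarrow> \<bar>Y \<omega>\<bar> \<le> (c :: real)"
  shows "(\<integral>\<omega>. Y \<omega> * indicator {d} (N u \<omega> - N t \<omega>) \<partial>M)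
    = (\<integral>\<omega>. Y \<omega> \<partial>M) * prob {\<omega> \<in> space M. N u \<omega> - N t \<omega> = d}"
proof -
  let ?D = "{\<omega> \<in> space M. N u \<omega> - N t \<omega> = d}"
  have [measurable]: "N u \<in> M \<rightarrow>\<^sub>M count_space UNIV" "N t \<in> M \<rightarrow>\<^sub>M count_space UNIV"
    using t N_measurable by auto
  have D: "?D \<in> events" by measurable
  have "indep_set (cylinders t) {?D}"
    using cylinder_increment_indep[OF t] D by (intro indep_setI) auto
  then have "indep_set (sigma_sets (space M) (cylinders t)) (sigma_sets (space M) {?D})"
    by (intro indep_set_sigma_sets Int_stable_cylinders) (auto simp: Int_stable_def)
  moreover have "sets (past t) \<subseteq> sigma_sets (space M) (cylinders t)"
    unfolding sets_past
  proof (rule sigma_sets_mono', safe)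
    fix s X assume s: "s \<in> {\<epsilon>..t}"
    show "N s -` X \<inter> space M \<in> cylinders t"
      by (rule cylindersI[where J="{s}" and Q="\<lambda>x. x s \<in> X"]) (use s in auto)
  qed
  ultimately have ind: "indep_set (sets (past t)) (sigma_sets (space M) {?D})"
    unfolding indep_sets2_eq by blast
  have [measurable]: "Y \<in> borel_measurable M" using past_measurable[OF _ Y] t by simp
  have "indep_var borel Y borel (indicator ?D :: _ \<Rightarrow> real)"
    unfolding indep_var_eq
  proof (intro conjI)
    have sub1: "sigma_sets (space M) {Y -` A \<inter> space M |A. A \<in> sets borel} \<subseteq> sets (past t)"
      using measurable_sets[OF Y] by (intro sets.sigma_sets_subset[of _ "past t", simplified]) auto
    have sub2: "sigma_sets (space M) {indicator ?D -` A \<inter> space M |A. A \<in> sets (borel :: real measure)}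
        \<subseteq> sigma_sets (space M) {?D}"
    proof (intro sigma_sets_mono subsetI, clarify)
      fix A :: "real set" assume A: "A \<in> sets borel"
      let ?L = "sigma (space M) {?D}"
      have L: "space ?L = space M" "sets ?L = sigma_sets (space M) {?D}"
        by (auto intro!: space_measure_of sets_measure_of)
      have "indicator ?D \<in> borel_measurable ?L"
        by (intro borel_measurable_indicator) (simp add: L sigma_sets.Basic)
      from measurable_sets[OF this A] show "indicator ?D -` A \<inter> space M \<in> sigma_sets (space M) {?D}"
        unfolding L .
    qed
    show "indep_set (sigma_sets (space M) {Y -` A \<inter> space M |A. A \<in> sets borel})
       (sigma_sets (space M) {indicator ?D -` A \<inter> space M |A. A \<in> sets (borel :: real measure)})"
      unfolding indep_set_def
      by (rule indep_sets_mono_sets[OF ind[unfolded indep_set_def]])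
        (use sub1 sub2 in \<open>simp split: bool.split\<close>)
  qed (use D in measurable)
  then have "(\<integral>\<omega>. Y \<omega> * indicator ?D \<omega> \<partial>M) = (\<integral>\<omega>. Y \<omega> \<partial>M) * (\<integral>\<omega>. indicator ?D \<omega> \<partial>M)"
  proof (rule indep_var_lebesgue_integral)
    show "integrable M Y"
      by (rule integrable_const_bound[where B=c]) (auto simp: bnd)
    show "integrable M (indicator ?D :: _ \<Rightarrow> real)"
      using D by (simp add: integrable_real_indicator emeasure_eq_measure)
  qed
  moreover have "(\<integral>\<omega>. Y \<omega> * indicator ?D \<omega> \<partial>M) = (\<integral>\<omega>. Y \<omega> * indicator {d} (N u \<omega> - N t \<omega>) \<partial>M)"
    by (intro Bochner_Integration.integral_cong) (auto simp: indicator_def)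
  ultimately show ?thesis using D by simp
qed

end

section \<open>Conditioning on a single call\<close>

text \<open>The clamped argument is approached from the right along grids of mesh
  \<open>1 / n\<close>, cut off at \<open>b\<close>. Each approximation is a function of an integer
  part, hence measurable whatever \<open>g\<close> is, and right continuity gives pointwise
  convergence.\<close>

lemma borel_measurable_right_continuous:
  fixes g :: "real \<Rightarrow> real"
  assumes ab: "a \<le> b" and g: "\<And>t. t \<in> {a..b} \<Longrightarrow> continuous (at t within {t..b}) g"
  shows "(\<lambda>x. g (max a (min b x))) \<in> borel_measurable borel"
proof -
  define y where "y x = max a (min b x)" for x
  define r where "r n x = min b ((of_int \<lfloor>of_nat n * y x\<rfloor> + 1) / of_nat n)" for n x
  have [measurable]: "y \<in> borel_measurable borel" unfolding y_def by measurable
  show ?thesis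
  proof (rule borel_measurable_LIMSEQ_real)
    fix x :: real
    have y: "y x \<in> {a..b}" using ab by (auto simp: y_def)
    have r: "y x \<le> r (Suc n) x \<and> r (Suc n) x \<le> b \<and> r (Suc n) x \<le> y x + 1 / Suc n" for n
    proof -
      let ?q = "(of_int \<lfloor>of_nat (Suc n) * y x\<rfloor> + 1) / of_nat (Suc n) :: real"
      have "of_nat (Suc n) * y x \<le> of_int \<lfloor>of_nat (Suc n) * y x\<rfloor> + 1" by linarith
      then have "y x \<le> ?q" by (simp add: pos_le_divide_eq mult.commute)
      moreover have "?q \<le> (of_nat (Suc n) * y x + 1) / of_nat (Suc n)"
        by (intro divide_right_mono) auto
      moreover have "\<dots> = y x + 1 / Suc n" by (simp add: add_divide_distrib)
      ultimately show ?thesis using y unfolding r_def by auto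
    qed
    have "(\<lambda>n. y x + 1 / Suc n) \<longlonglongrightarrow> y x + 0"
      using LIMSEQ_inverse_real_of_nat by (intro tendsto_intros) (simp add: inverse_eq_divide)
    then have lim: "(\<lambda>n. y x + 1 / Suc n) \<longlonglongrightarrow> y x" by simp
    have "(\<lambda>n. r (Suc n) x) \<longlonglongrightarrow> y x"
      by (rule real_tendsto_sandwich[OF _ _ tendsto_const lim]; rule always_eventually; use r in blast)
    moreover have "\<forall>n. r (Suc n) x \<in> {y x..b}" using r by auto
    ultimately show "(\<lambda>n. g (r (Suc n) x)) \<longlonglongrightarrow> g (max a (min b x))"
      using g[OF y] unfolding continuous_within_sequentially y_def[symmetric] comp_def by simp
  next
    fix n
    have "(\<lambda>x. g (min b ((of_int \<lfloor>of_nat (Suc n) * y x\<rfloor> + 1) / of_nat (Suc n)))) \<in> borel_measurable borel"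
      by (rule measurable_compose[of "\<lambda>x. \<lfloor>of_nat (Suc n) * y x\<rfloor>" _ "count_space UNIV"
          "\<lambda>z. g (min b ((of_int z + 1) / of_nat (Suc n)))"]) auto
    then show "(\<lambda>x. g (r (Suc n) x)) \<in> borel_measurable borel" unfolding r_def .
  qed
qed

lemma sum_indicator_singleton:
  fixes g :: "'b \<Rightarrow> real"
  assumes "finite B" "s \<in> B"
  shows "(\<Sum>p\<in>B. g p * indicator {p} s) = g s"
proof -
  have "(\<Sum>p\<in>B. g p * indicator {p} s) = (\<Sum>p\<in>B. if p = s then g p else 0)"
    by (intro sum.cong) (auto simp: indicator_def)
  then show ?thesis using assms by simp
qed

lemma count_space_UNIV_of: "X \<in> L \<rightarrow>\<^sub>M count_space A \<Longrightarrow> X \<in> L \<rightarrow>\<^sub>M count_space UNIV"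
  by (rule measurable_compose[of X L "count_space A" "\<lambda>x. x"]) auto

lemma borel_measurable_of_count:
  "X \<in> L \<rightarrow>\<^sub>M count_space UNIV \<Longrightarrow> (\<lambda>\<omega>. g (X \<omega>) :: real) \<in> borel_measurable L"
  by (rule measurable_compose) auto

lemma (in finite_measure) integrable_bounded:
  "V \<in> borel_measurable M \<Longrightarrow> (\<And>\<omega>. \<omega> \<in> space M \<Longrightarrow> \<bar>V \<omega>\<bar> \<le> (c::real)) \<Longrightarrow> integrable M V"
  by (rule integrable_const_bound[where B=c]) auto

section \<open>Runs of the process: histories, number of calls, conditional laws\<close>

locale greedy_run = matroid U Ind + poisson_run M "\<lambda>t. real (matroid_rank Ind) / t" \<epsilon> N
  for U :: "'a set" and Ind and \<epsilon> :: real and M :: "'w measure" and N +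
  fixes swap :: "real \<Rightarrow> 'a set \<Rightarrow> ('a \<times> 'a) pmf"
    and A\<^sub>0 :: "'a set" and S :: "nat \<Rightarrow> 'w \<Rightarrow> 'a \<times> 'a"
  assumes eps_pos: "0 < \<epsilon>"
    and swap_proc: "swap_procedure U Ind \<epsilon> swap"
    and swap_cont: "right_continuous_swap U Ind \<epsilon> swap"
    and run: "greedy_swap_poisson_process U Ind \<epsilon> swap A\<^sub>0 M N S"
begin

abbreviation "k \<equiv> matroid_rank Ind"
abbreviation "cur \<equiv> current_set A\<^sub>0 S"
abbreviation "hist \<equiv> history M \<epsilon> N S"
abbreviation "etime n \<omega> \<equiv> event_time \<epsilon> N n \<omega>"

lemma base_subset: "A \<in> bases Ind \<Longrightarrow> A \<subseteq> U"
  using indep_subset_ground by (auto simp: bases_def)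

lemma finite_bases: "finite (bases Ind)"
  by (rule finite_subset[of _ "Pow U"]) (use base_subset finite_ground in auto)

lemma finite_UU: "finite (U \<times> U)"
  using finite_ground by simp

lemma A0_base: "A\<^sub>0 \<in> bases Ind"
  using run by (simp add: greedy_swap_poisson_process_def)

lemma S_measurable: "S n \<in> M \<rightarrow>\<^sub>M count_space (U \<times> U)"
  using run by (simp add: greedy_swap_poisson_process_def)

lemma S_in: "\<omega> \<in> space M \<Longrightarrow> S n \<omega> \<in> U \<times> U"
  using measurable_space[OF S_measurable] by auto

lemma cur_subset: "\<omega> \<in> space M \<Longrightarrow> cur n \<omega> \<subseteq> U"
proof (induction n)
  case 0 then show ?case using A0_base base_subset by auto
next
  case (Suc n)
  then show ?case using S_in[of \<omega> n] by (auto simp: apply_swap_def split: prod.splits)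
qed

lemma call_law:
  "i \<in> U \<Longrightarrow> j \<in> U \<Longrightarrow> AE \<omega> in M. n < num_calls \<epsilon> N \<omega> \<longrightarrow>
    real_cond_exp M (hist n) (indicator {\<omega> \<in> space M. S n \<omega> = (i, j)}) \<omega>
      = pmf (swap (etime n \<omega>) (cur n \<omega>)) (i, j)"
  using run by (simp add: greedy_swap_poisson_process_def)

lemma space_hist [simp]: "space (hist n) = space M"
  unfolding history_def by (rule space_measure_of) auto

lemma sets_hist: "sets (hist n) = sigma_sets (space M)
     ({N t -` X \<inter> space M | t X. t \<in> {\<epsilon>..1}} \<union> {S m -` X \<inter> space M | m X. m < n})"
  unfolding history_def by (rule sets_measure_of) auto

lemma N_hist: "t \<in> {\<epsilon>..1} \<Longrightarrow> N t \<in> hist n \<rightarrow>\<^sub>M count_space UNIV"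
  by (rule measurableI) (auto simp: sets_hist intro!: sigma_sets.Basic)

lemma S_hist: "m < n \<Longrightarrow> S m \<in> hist n \<rightarrow>\<^sub>M count_space (U \<times> U)"
  by (rule measurableI) (auto simp: sets_hist S_in)

lemma hist_events: "sets (hist n) \<subseteq> events"
proof -
  have "S m -` X \<inter> space M \<in> events" for m X
  proof -
    have "S m -` X \<inter> space M = S m -` (X \<inter> U \<times> U) \<inter> space M" using S_in by auto
    then show ?thesis using measurable_sets[OF S_measurable, of "X \<inter> U \<times> U" m] by simp
  qed
  then show ?thesis
    unfolding sets_hist by (intro sets.sigma_sets_subset) (auto intro!: measurable_sets[OF N_measurable])
qed

lemma hist_measurable: "Y \<in> hist n \<rightarrow>\<^sub>M L \<Longrightarrow> Y \<in> M \<rightarrow>\<^sub>M L"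
  using hist_events by (auto simp: measurable_def)

lemma past_hist: "t \<le> 1 \<Longrightarrow> Y \<in> past t \<rightarrow>\<^sub>M L \<Longrightarrow> Y \<in> hist n \<rightarrow>\<^sub>M L"
proof -
  assume t: "t \<le> 1" and Y: "Y \<in> past t \<rightarrow>\<^sub>M L"
  have "sets (past t) \<subseteq> sets (hist n)"
    unfolding sets_past sets_hist
  proof (rule sigma_sets_mono', rule subsetI)
    fix C assume "C \<in> {N s -` X \<inter> space M | s X. s \<in> {\<epsilon>..t}}"
    then obtain s X where s: "C = N s -` X \<inter> space M" "s \<in> {\<epsilon>..t}" by blast
    show "C \<in> {N t -` X \<inter> space M | t X. t \<in> {\<epsilon>..1}} \<union>
        {S m -` X \<inter> space M | m X. m < n}"
      by (intro UnI1 CollectI exI[of _ s] exI[of _ X]) (use s t in auto)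
  qed
  then show ?thesis using Y by (auto simp: measurable_def)
qed

text \<open>The \<sigma>-algebra is left general to serve both \<open>hist n\<close> and
  \<open>M\<close>; in the former only the calls before \<open>n\<close> are available.\<close>

lemma cur_measurable_gen:
  assumes L: "space L = space M" "\<And>m. m < n \<Longrightarrow> S m \<in> L \<rightarrow>\<^sub>M count_space (U \<times> U)"
  shows "cur n \<in> L \<rightarrow>\<^sub>M count_space (Pow U)"
  using L(2)
proof (induction n)
  case 0
  then show ?case using A0_base base_subset by (auto intro!: measurable_const)
next
  case (Suc n)
  have c: "cur n \<in> L \<rightarrow>\<^sub>M count_space (Pow U)" and s: "S n \<in> L \<rightarrow>\<^sub>M count_space (U \<times> U)"
    using Suc by auto
  have "(\<lambda>\<omega>. (cur n \<omega>, S n \<omega>)) \<in> L \<rightarrow>\<^sub>M count_space (Pow U \<times> (U \<times> U))"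
  proof (subst measurable_count_space_eq2)
    show "finite (Pow U \<times> (U \<times> U))" using finite_ground by simp
    show "(\<lambda>\<omega>. (cur n \<omega>, S n \<omega>)) \<in> space L \<rightarrow> Pow U \<times> U \<times> U \<and>
      (\<forall>a\<in>Pow U \<times> U \<times> U. (\<lambda>\<omega>. (cur n \<omega>, S n \<omega>)) -` {a} \<inter> space L \<in> sets L)"
    proof (intro conjI ballI)
      show "(\<lambda>\<omega>. (cur n \<omega>, S n \<omega>)) \<in> space L \<rightarrow> Pow U \<times> U \<times> U"
        using cur_subset S_in L(1) by blast
      fix a :: "'a set \<times> 'a \<times> 'a" assume a: "a \<in> Pow U \<times> U \<times> U"
      have "(\<lambda>\<omega>. (cur n \<omega>, S n \<omega>)) -` {a} \<inter> space L =
        (cur n -` {fst a} \<inter> space L) \<inter> (S n -` {snd a} \<inter> space L)" by auto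
      moreover have "cur n -` {fst a} \<inter> space L \<in> sets L" "S n -` {snd a} \<inter> space L \<in> sets L"
        using a by (auto intro!: measurable_sets[OF c] measurable_sets[OF s])
      ultimately show "(\<lambda>\<omega>. (cur n \<omega>, S n \<omega>)) -` {a} \<inter> space L \<in> sets L" by simp
    qed
  qed
  moreover have "(\<lambda>(A, p). apply_swap A p) \<in> count_space (Pow U \<times> (U \<times> U)) \<rightarrow>\<^sub>M count_space (Pow U)"
    by (auto simp: apply_swap_def split: prod.splits)
  ultimately have "(\<lambda>\<omega>. (\<lambda>(A, p). apply_swap A p) (cur n \<omega>, S n \<omega>)) \<in> L \<rightarrow>\<^sub>M count_space (Pow U)"
    by (rule measurable_compose)
  then show ?case by simp
qed

lemma cur_hist: "cur n \<in> hist n \<rightarrow>\<^sub>M count_space UNIV"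
  by (rule count_space_UNIV_of[OF cur_measurable_gen]) (use S_hist in auto)

lemma cur_measurable: "cur n \<in> M \<rightarrow>\<^sub>M count_space UNIV"
  by (rule count_space_UNIV_of[OF cur_measurable_gen]) (use S_measurable in auto)

lemma S_measurable': "S n \<in> M \<rightarrow>\<^sub>M count_space UNIV"
  by (rule count_space_UNIV_of[OF S_measurable])

text \<open>Clamping \<open>t\<close> turns right continuity on \<open>{\<epsilon>..1}\<close> into measurability on the whole line.\<close>

definition swap_prob :: "'a set \<Rightarrow> 'a \<times> 'a \<Rightarrow> real \<Rightarrow> real" where
  "swap_prob A p t = pmf (swap (max \<epsilon> (min 1 t)) A) p"

lemma swap_prob_eq: "t \<in> {\<epsilon>..1} \<Longrightarrow> swap_prob A p t = pmf (swap t A) p"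
  by (auto simp: swap_prob_def max_def min_def intro: order_antisym)

lemma swap_prob_bounds: "0 \<le> swap_prob A p t" "swap_prob A p t \<le> 1"
  by (simp_all add: swap_prob_def pmf_le_1)

lemma swap_prob_measurable:
  assumes "A \<in> bases Ind" "p \<in> U \<times> U"
  shows "swap_prob A p \<in> borel_measurable borel"
proof -
  have "(\<lambda>t. (\<lambda>s. pmf (swap s A) p) (max \<epsilon> (min 1 t))) \<in> borel_measurable borel"
    by (rule borel_measurable_right_continuous[OF eps_le])
      (use swap_cont assms in \<open>auto simp: right_continuous_swap_def\<close>)
  then show ?thesis by (simp add: swap_prob_def[abs_def])
qed

lemma rate_integral:
  assumes "\<epsilon> \<le> s" "s \<le> t"
  shows "integral {s..t} (\<lambda>t. real k / t) = real k * ln (t / s)"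
proof -
  have "((\<lambda>t. real k / t) has_integral (real k * ln t - real k * ln s)) {s..t}"
    using assms eps_pos
    by (intro fundamental_theorem_of_calculus)
      (auto intro!: derivative_eq_intros simp flip: has_real_derivative_iff_has_vector_derivative)
  then show ?thesis using assms eps_pos
    by (simp add: integral_unique ln_div right_diff_distrib)
qed

lemma increment_prob:
  assumes "\<epsilon> \<le> s" "s \<le> t" "t \<le> 1"
  shows "prob {\<omega> \<in> space M. N t \<omega> - N s \<omega> = d} =
    (real k * ln (t / s)) ^ d / fact d * exp (- (real k * ln (t / s)))"
  using N_increment_prob[of s t d] assms by (simp add: rate_integral)

lemma event_time_measurable: "(\<lambda>\<omega>. if n < N 1 \<omega> then etime n \<omega> else 1) \<in> borel_measurable M"
  by (rule measurable_event_time) (use N_measurable eps_le in auto)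

text \<open>An event exactly at time \<open>1\<close> forces an increment on every interval from
  \<open>s < 1\<close> to \<open>1\<close>, and the probability of such an increment vanishes as
  \<open>s\<close> tends to \<open>1\<close>. Consequently the number of calls is almost surely
  \<open>N 1\<close>.\<close>

lemma AE_event_before_one: "AE \<omega> in M. \<forall>n. n < N 1 \<omega> \<longrightarrow> etime n \<omega> < 1"
proof (cases "\<epsilon> = 1")
  case True
  then show ?thesis using N_start by (intro AE_I2) auto
next
  case False
  then have e: "\<epsilon> < 1" using eps_le by simp
  have [measurable]: "N 1 \<in> M \<rightarrow>\<^sub>M count_space UNIV" using N_measurable eps_le by simp
  have "AE \<omega> in M. n < N 1 \<omega> \<longrightarrow> etime n \<omega> < 1" for n
  proof -
    note [measurable] = event_time_measurable[of n]
    let ?T = "\<lambda>\<omega>. if n < N 1 \<omega> then etime n \<omega> else 1"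
    let ?B = "{\<omega> \<in> space M. n < N 1 \<omega> \<and> \<not> ?T \<omega> < 1}"
    have B: "?B \<in> events" by measurable
    have le: "prob ?B \<le> 1 - exp (- (real k * ln (1 / s)))" if s: "s \<in> {\<epsilon><..<1}" for s
    proof -
      have [measurable]: "N s \<in> M \<rightarrow>\<^sub>M count_space UNIV" using N_measurable s by simp
      have "?B \<subseteq> space M - {\<omega> \<in> space M. N 1 \<omega> - N s \<omega> = 0}"
      proof safe
        fix \<omega> assume \<omega>: "\<omega> \<in> space M" "n < N 1 \<omega>" "\<not> ?T \<omega> < 1" "N 1 \<omega> - N s \<omega> = 0"
        then have "n < N s \<omega>" by simp
        then show False using event_time_le_iff[OF \<omega>(1,2), of s] s \<omega> by auto
      qed
      then have "prob ?B \<le> prob (space M - {\<omega> \<in> space M. N 1 \<omega> - N s \<omega> = 0})"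
        by (intro finite_measure_mono) measurable
      also have "\<dots> = 1 - prob {\<omega> \<in> space M. N 1 \<omega> - N s \<omega> = 0}" by (rule prob_compl) measurable
      also have "\<dots> = 1 - exp (- (real k * ln (1 / s)))" using s by (subst increment_prob) auto
      finally show ?thesis .
    qed
    have "((\<lambda>s. 1 - exp (- (real k * ln (1 / s)))) \<longlongrightarrow> 1 - exp (- (real k * ln (1 / 1)))) (at_left 1)"
      by (intro tendsto_intros) auto
    moreover have "\<forall>\<^sub>F s in at_left 1. prob ?B \<le> 1 - exp (- (real k * ln (1 / s)))"
      using eventually_at_left_real[OF e] by (rule eventually_mono) (use le in blast)
    ultimately have "prob ?B \<le> 1 - exp (- (real k * ln (1 / 1)))"
      by (intro tendsto_lowerbound) auto
    then have "prob ?B = 0" using measure_nonneg[of M ?B] by simp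
    then have "AE \<omega> in M. \<omega> \<notin> ?B" using B prob_eq_0 by blast
    then show ?thesis by (rule AE_mp) (auto intro!: AE_I2)
  qed
  then show ?thesis by (simp add: AE_all_countable)
qed

lemma AE_num_calls: "AE \<omega> in M. num_calls \<epsilon> N \<omega> = N 1 \<omega>"
  using AE_event_before_one
proof (rule AE_mp, intro AE_I2 impI)
  fix \<omega> assume \<omega>: "\<omega> \<in> space M" "\<forall>n. n < N 1 \<omega> \<longrightarrow> etime n \<omega> < 1"
  then have "\<And>n. n < num_calls \<epsilon> N \<omega> \<longleftrightarrow> n < N 1 \<omega>" by (auto simp: num_calls_iff)
  then show "num_calls \<epsilon> N \<omega> = N 1 \<omega>" by (metis linorder_neqE_nat less_irrefl)
qed

lemma num_calls_measurable: "num_calls \<epsilon> N \<in> M \<rightarrow>\<^sub>M count_space UNIV"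
proof -
  have [measurable]: "N 1 \<in> M \<rightarrow>\<^sub>M count_space UNIV" using N_measurable eps_le by simp
  have gt: "{\<omega> \<in> space M. n < num_calls \<epsilon> N \<omega>} \<in> events" for n
  proof -
    note [measurable] = event_time_measurable[of n]
    have "{\<omega> \<in> space M. n < num_calls \<epsilon> N \<omega>} =
      {\<omega> \<in> space M. n < N 1 \<omega> \<and> (if n < N 1 \<omega> then etime n \<omega> else 1) < 1}"
      using num_calls_iff by auto
    also have "\<dots> \<in> events" by measurable
    finally show ?thesis .
  qed
  have "num_calls \<epsilon> N -` {n} \<inter> space M =
      (if n = 0 then space M else {\<omega> \<in> space M. n - 1 < num_calls \<epsilon> N \<omega>}) - {\<omega> \<in> space M. n < num_calls \<epsilon> N \<omega>}" for n
    by auto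
  then show ?thesis using gt by (subst measurable_count_space_eq2_countable) auto
qed

text \<open>The conditional law of a call in integrated form. \<open>Z\<close> may depend on the
  whole event process, including its future, because \<open>hist n\<close> contains it. Fixing
  \<open>A\<close> keeps the swap probability a function of one real variable.\<close>

lemma call_expectation:
  assumes A: "A \<in> bases Ind" and p: "p \<in> U \<times> U"
    and Z: "Z \<in> borel_measurable (hist n)" "\<And>\<omega>. \<omega> \<in> space M \<Longrightarrow> \<bar>Z \<omega>\<bar> \<le> (c :: real)"
      "\<And>\<omega>. \<omega> \<in> space M \<Longrightarrow> Z \<omega> \<noteq> 0 \<Longrightarrow> n < N 1 \<omega>"
  shows "(\<integral>\<omega>. indicator {A} (cur n \<omega>) * Z \<omega> * indicator {p} (S n \<omega>) \<partial>M) =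
    (\<integral>\<omega>. indicator {A} (cur n \<omega>) * (swap_prob A p (etime n \<omega>) * Z \<omega>) \<partial>M)"
proof -
  interpret H: finite_measure_subalgebra M "hist n"
    by unfold_locales (use hist_events in \<open>auto simp: subalgebra_def\<close>)
  obtain i j where ij: "p = (i, j)" "i \<in> U" "j \<in> U" using p by auto
  note [measurable] = cur_hist[of n] Z(1) S_measurable'[of n]
  let ?W = "\<lambda>\<omega>. indicator {A} (cur n \<omega>) * Z \<omega>"
  let ?I = "indicator {\<omega> \<in> space M. S n \<omega> = p} :: 'w \<Rightarrow> real"
  have W[measurable]: "?W \<in> borel_measurable (hist n)"
    by (intro borel_measurable_times Z(1) borel_measurable_of_count cur_hist)
  have W'[measurable]: "?W \<in> borel_measurable M" by (rule hist_measurable[OF W])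
  have Z'[measurable]: "Z \<in> borel_measurable M" by (rule hist_measurable[OF Z(1)])
  have I[measurable]: "?I \<in> borel_measurable M" by measurable
  have int: "integrable M (\<lambda>\<omega>. ?W \<omega> * ?I \<omega>)"
  proof (rule integrable_bounded)
    show "\<bar>?W \<omega> * ?I \<omega>\<bar> \<le> c" if "\<omega> \<in> space M" for \<omega>
      using Z(2)[OF that] by (auto simp: indicator_def)
  qed measurable
  \<comment> \<open>If event \<open>n\<close> does not occur, \<open>event_time\<close> is an
    infimum over the empty set; the default \<open>1\<close> gives a measurable variable, and
    \<open>Z\<close> vanishes there.\<close>
  let ?T = "\<lambda>\<omega>. if n < N 1 \<omega> then etime n \<omega> else 1"
  have T_meas[measurable]: "(\<lambda>\<omega>. swap_prob A p (?T \<omega>)) \<in> borel_measurable M"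
    by (rule measurable_compose[OF event_time_measurable swap_prob_measurable[OF A p]])
  have [measurable]: "(\<lambda>\<omega>. indicator {A} (cur n \<omega>) :: real) \<in> borel_measurable M"
    by (rule borel_measurable_of_count[OF cur_measurable])
  have T: "indicator {A} (cur n \<omega>) * (swap_prob A p (?T \<omega>) * Z \<omega>) =
      indicator {A} (cur n \<omega>) * (swap_prob A p (etime n \<omega>) * Z \<omega>)" if "\<omega> \<in> space M" for \<omega>
    using Z(3)[OF that] by auto
  have "(\<integral>\<omega>. ?W \<omega> * indicator {p} (S n \<omega>) \<partial>M) = (\<integral>\<omega>. ?W \<omega> * ?I \<omega> \<partial>M)"
    by (intro Bochner_Integration.integral_cong) (auto simp: indicator_def)
  also have "\<dots> = (\<integral>\<omega>. ?W \<omega> * real_cond_exp M (hist n) ?I \<omega> \<partial>M)"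
    by (rule H.real_cond_exp_intg(2)[OF int W I, symmetric])
  also have "\<dots> = (\<integral>\<omega>. indicator {A} (cur n \<omega>) * (swap_prob A p (?T \<omega>) * Z \<omega>) \<partial>M)"
  proof (rule integral_cong_AE)
    show "(\<lambda>\<omega>. ?W \<omega> * real_cond_exp M (hist n) ?I \<omega>) \<in> borel_measurable M"
      by (intro borel_measurable_times W' borel_measurable_cond_exp2)
    show "AE \<omega> in M. ?W \<omega> * real_cond_exp M (hist n) ?I \<omega> =
       indicator {A} (cur n \<omega>) * (swap_prob A p (?T \<omega>) * Z \<omega>)"
      using call_law[OF ij(2,3), of n] AE_num_calls AE_space
    proof eventually_elim
      case (elim \<omega>)
      show ?case
      proof (cases "Z \<omega> = 0 \<or> cur n \<omega> \<noteq> A")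
        case False
        then have "n < N 1 \<omega>" using Z(3) elim by auto
        then show ?thesis
          using elim False event_time_bounds[of \<omega> n] by (simp add: swap_prob_eq ij)
      qed (auto simp: indicator_def)
    qed
  qed (intro borel_measurable_times Z' T_meas borel_measurable_of_count cur_measurable)
  also have "\<dots> = (\<integral>\<omega>. indicator {A} (cur n \<omega>) * (swap_prob A p (etime n \<omega>) * Z \<omega>) \<partial>M)"
    by (intro Bochner_Integration.integral_cong refl T)
  finally show ?thesis .
qed

text \<open>\<open>swap_procedure\<close> constrains the support of \<open>swap\<close>, whereas
  \<open>S n\<close> merely has the right conditional law. So each of the finitely many forbidden
  combinations of base and pair is shown to be a null event.\<close>

lemma AE_cur_base: "AE \<omega> in M. n \<le> N 1 \<omega> \<longrightarrow> cur n \<omega> \<in> bases Ind"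
proof (induction n)
  case 0
  then show ?case using A0_base by simp
next
  case (Suc n)
  note [measurable] = cur_measurable[of n] S_measurable'[of n] cur_hist[of n]
  have N1: "N 1 \<in> M \<rightarrow>\<^sub>M count_space UNIV" "N 1 \<in> hist n \<rightarrow>\<^sub>M count_space UNIV"
    using N_measurable N_hist eps_le by simp_all
  have "AE \<omega> in M. n < N 1 \<omega> \<longrightarrow> cur n \<omega> = A \<longrightarrow> S n \<omega> \<noteq> p"
    if A: "A \<in> bases Ind" and p: "p \<in> U \<times> U" and nb: "apply_swap A p \<notin> bases Ind" for A p
  proof -
    let ?Z = "\<lambda>\<omega>. indicator {n<..} (N 1 \<omega>) :: real"
    note [measurable] = N1(1)
    let ?B = "{\<omega> \<in> space M. n < N 1 \<omega> \<and> cur n \<omega> = A \<and> S n \<omega> = p}"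
    have B: "?B \<in> events" by measurable
    have "prob ?B = (\<integral>\<omega>. indicator ?B \<omega> \<partial>M)" using B by simp
    also have "\<dots> = (\<integral>\<omega>. indicator {A} (cur n \<omega>) * ?Z \<omega> * indicator {p} (S n \<omega>) \<partial>M)"
      by (intro Bochner_Integration.integral_cong) (auto simp: indicator_def)
    also have "\<dots> = (\<integral>\<omega>. indicator {A} (cur n \<omega>) * (swap_prob A p (etime n \<omega>) * ?Z \<omega>) \<partial>M)"
      by (rule call_expectation[OF A p, where c=1])
        (auto simp: indicator_def intro: measurable_compose[OF N1(2)] split: if_splits)
    also have "\<dots> = (\<integral>\<omega>. 0 \<partial>M)"
    proof (intro Bochner_Integration.integral_cong refl)
      fix \<omega> assume \<omega>: "\<omega> \<in> space M"
      have "swap_prob A p (etime n \<omega>) = 0" if n: "n < N 1 \<omega>"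
      proof -
        have "p \<notin> set_pmf (swap (etime n \<omega>) A)"
          using swap_proc A nb event_time_bounds[OF \<omega> n] by (cases p) (fastforce simp: swap_procedure_def)
        then show ?thesis
          using event_time_bounds[OF \<omega> n] by (simp add: swap_prob_eq pmf_eq_0_set_pmf)
      qed
      then show "indicator {A} (cur n \<omega>) * (swap_prob A p (etime n \<omega>) * ?Z \<omega>) = 0"
        by (auto simp: indicator_def)
    qed
    finally have "prob ?B = 0" by simp
    then have "AE \<omega> in M. \<omega> \<notin> ?B" using B prob_eq_0 by blast
    then show ?thesis by (rule AE_mp) (auto intro!: AE_I2)
  qed
  then have "AE \<omega> in M. \<forall>A\<in>bases Ind. \<forall>p\<in>U \<times> U. apply_swap A p \<notin> bases Ind \<longrightarrow>
      n < N 1 \<omega> \<longrightarrow> cur n \<omega> = A \<longrightarrow> S n \<omega> \<noteq> p"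
    by (intro AE_finite_allI finite_bases finite_UU) auto
  with Suc AE_space show ?case
  proof eventually_elim
    case (elim \<omega>)
    show ?case
    proof
      assume n: "Suc n \<le> N 1 \<omega>"
      then have "n < N 1 \<omega>" and base: "cur n \<omega> \<in> bases Ind" using elim(1) by simp_all
      then have "apply_swap (cur n \<omega>) (S n \<omega>) \<in> bases Ind"
        using elim(3)[THEN bspec, OF base, THEN bspec, OF S_in[OF elim(2)], of n] by auto
      then show "cur (Suc n) \<omega> \<in> bases Ind" by simp
    qed
  qed
qed

text \<open>Summing over the finitely many bases and pairs integrates out the result of call
  \<open>n\<close>: the right-hand side no longer mentions \<open>S n\<close>. This is how
  statements about \<open>Suc n\<close> calls are reduced to \<open>n\<close> calls.\<close>

lemma cur_Suc_expectation:
  fixes \<phi> :: "'a set \<Rightarrow> 'a \<times> 'a \<Rightarrow> real"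
  assumes Z: "Z \<in> borel_measurable (hist n)" "\<And>\<omega>. \<omega> \<in> space M \<Longrightarrow> \<bar>Z \<omega>\<bar> \<le> (c :: real)"
      "\<And>\<omega>. \<omega> \<in> space M \<Longrightarrow> Z \<omega> \<noteq> 0 \<Longrightarrow> n < N 1 \<omega>"
  shows "(\<integral>\<omega>. \<phi> (cur n \<omega>) (S n \<omega>) * Z \<omega> \<partial>M) =
    (\<Sum>A\<in>bases Ind. \<Sum>p\<in>U \<times> U. \<phi> A p *
      (\<integral>\<omega>. indicator {A} (cur n \<omega>) * (swap_prob A p (etime n \<omega>) * Z \<omega>) \<partial>M))"
proof -
  have [measurable]: "Z \<in> borel_measurable M" by (rule hist_measurable[OF Z(1)])
  note [measurable] = borel_measurable_of_count[OF cur_measurable[of n]]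
    borel_measurable_of_count[OF S_measurable'[of n]]
  have int: "integrable M (\<lambda>\<omega>. indicator {A} (cur n \<omega>) * Z \<omega> * indicator {p} (S n \<omega>))" for A p
  proof (rule integrable_bounded)
    show "\<bar>indicator {A} (cur n \<omega>) * Z \<omega> * indicator {p} (S n \<omega>)\<bar> \<le> c" if "\<omega> \<in> space M" for \<omega>
      using Z(2)[OF that] by (auto simp: indicator_def)
  qed measurable
  have "(\<integral>\<omega>. \<phi> (cur n \<omega>) (S n \<omega>) * Z \<omega> \<partial>M) = (\<integral>\<omega>. (\<Sum>A\<in>bases Ind. \<Sum>p\<in>U \<times> U. \<phi> A p *
      (indicator {A} (cur n \<omega>) * Z \<omega> * indicator {p} (S n \<omega>))) \<partial>M)"
  proof (rule integral_cong_AE)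
    have "(\<lambda>\<omega>. \<phi> (cur n \<omega>) (S n \<omega>)) \<in> borel_measurable M"
    proof (rule measurable_compose_countable'[where g="cur n" and I="Pow U"])
      show "cur n \<in> M \<rightarrow>\<^sub>M count_space (Pow U)" by (rule cur_measurable_gen) (auto intro: S_measurable)
      show "countable (Pow U)" using finite_ground by (simp add: countable_finite)
      show "(\<lambda>x. \<phi> A (S n x)) \<in> borel_measurable M" for A
        by (rule measurable_compose[OF S_measurable']) simp
    qed
    then show "(\<lambda>\<omega>. \<phi> (cur n \<omega>) (S n \<omega>) * Z \<omega>) \<in> borel_measurable M" by measurable
    show "AE \<omega> in M. \<phi> (cur n \<omega>) (S n \<omega>) * Z \<omega> = (\<Sum>A\<in>bases Ind. \<Sum>p\<in>U \<times> U. \<phi> A p *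
      (indicator {A} (cur n \<omega>) * Z \<omega> * indicator {p} (S n \<omega>)))"
      using AE_cur_base[of n] AE_space
    proof eventually_elim
      case (elim \<omega>)
      have "(\<Sum>p\<in>U \<times> U. \<phi> A p * (indicator {A} (cur n \<omega>) * Z \<omega> * indicator {p} (S n \<omega>))) =
          \<phi> A (S n \<omega>) * Z \<omega> * indicator {A} (cur n \<omega>)" for A
        using sum_indicator_singleton[OF finite_UU S_in[OF elim(2), of n],
            of "\<lambda>p. \<phi> A p * (indicator {A} (cur n \<omega>) * Z \<omega>)"]
        by (simp add: mult_ac)
      moreover have "(\<Sum>A\<in>bases Ind. \<phi> A (S n \<omega>) * Z \<omega> * indicator {A} (cur n \<omega>)) =
          \<phi> (cur n \<omega>) (S n \<omega>) * Z \<omega>"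
      proof (cases "Z \<omega> = 0")
        case False
        then have "cur n \<omega> \<in> bases Ind" using Z(3) elim by (auto dest: less_imp_le)
        then show ?thesis
          by (rule sum_indicator_singleton[OF finite_bases])
      qed simp
      ultimately show ?case by simp
    qed
  qed measurable
  also have "\<dots> = (\<Sum>A\<in>bases Ind. \<Sum>p\<in>U \<times> U. \<phi> A p *
      (\<integral>\<omega>. indicator {A} (cur n \<omega>) * Z \<omega> * indicator {p} (S n \<omega>) \<partial>M))"
  proof (subst Bochner_Integration.integral_sum)
    show "integrable M (\<lambda>\<omega>. \<Sum>p\<in>U \<times> U. \<phi> A p *
        (indicator {A} (cur n \<omega>) * Z \<omega> * indicator {p} (S n \<omega>)))" for A
      by (intro Bochner_Integration.integrable_sum integrable_mult_right int)
    show "(\<Sum>A\<in>bases Ind. \<integral>\<omega>. (\<Sum>p\<in>U \<times> U. \<phi> A p *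
        (indicator {A} (cur n \<omega>) * Z \<omega> * indicator {p} (S n \<omega>))) \<partial>M) =
      (\<Sum>A\<in>bases Ind. \<Sum>p\<in>U \<times> U. \<phi> A p *
        (\<integral>\<omega>. indicator {A} (cur n \<omega>) * Z \<omega> * indicator {p} (S n \<omega>) \<partial>M))"
    proof (rule sum.cong[OF refl])
      fix A
      show "(\<integral>\<omega>. (\<Sum>p\<in>U \<times> U. \<phi> A p *
          (indicator {A} (cur n \<omega>) * Z \<omega> * indicator {p} (S n \<omega>))) \<partial>M) =
        (\<Sum>p\<in>U \<times> U. \<phi> A p *
          (\<integral>\<omega>. indicator {A} (cur n \<omega>) * Z \<omega> * indicator {p} (S n \<omega>) \<partial>M))"
        by (subst Bochner_Integration.integral_sum)
          (intro integrable_mult_right int, simp)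
    qed
  qed
  also have "\<dots> = (\<Sum>A\<in>bases Ind. \<Sum>p\<in>U \<times> U. \<phi> A p *
      (\<integral>\<omega>. indicator {A} (cur n \<omega>) * (swap_prob A p (etime n \<omega>) * Z \<omega>) \<partial>M))"
    by (intro sum.cong refl arg_cong2[where f="(*)"] call_expectation[OF _ _ Z])
  finally show ?thesis .
qed

end

section \<open>Independence of the current base and the next increment\<close>

context greedy_run
begin


text \<open>The weight \<open>Y\<close> makes the induction close: removing the last call multiplies
  it by a swap probability at an event time, which stays measurable in the past because
  \<open>Y \<omega> \<noteq> 0\<close> forces all calls involved to occur by time \<open>t\<close>.
  With no calls left, \<open>past_increment_indep\<close> applies.\<close>

lemma past_current_indep:
  assumes t: "t \<in> {\<epsilon>..1}" "u \<in> {t..1}"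
    and Y: "Y \<in> borel_measurable (past t)" "\<And>\<omega>. \<omega> \<in> space M \<Longrightarrow> \<bar>Y \<omega>\<bar> \<le> (c :: real)"
      "\<And>\<omega>. \<omega> \<in> space M \<Longrightarrow> Y \<omega> \<noteq> 0 \<Longrightarrow> n \<le> N t \<omega>"
  shows "(\<integral>\<omega>. indicator {A} (cur n \<omega>) * (Y \<omega> * indicator {d} (N u \<omega> - N t \<omega>)) \<partial>M) =
    (\<integral>\<omega>. indicator {A} (cur n \<omega>) * Y \<omega> \<partial>M) * prob {\<omega> \<in> space M. N u \<omega> - N t \<omega> = d}"
  using Y
proof (induction n arbitrary: A Y)
  case 0
  then show ?case using past_increment_indep[OF t 0(1,2), of d] by (simp add: mult.assoc)
next
  case (Suc n)
  let ?D = "\<lambda>\<omega>. indicator {d} (N u \<omega> - N t \<omega>) :: real"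
  let ?P = "prob {\<omega> \<in> space M. N u \<omega> - N t \<omega> = d}"
  have N1: "n < N 1 \<omega>" "n < N t \<omega>" if "\<omega> \<in> space M" "Y \<omega> \<noteq> 0" for \<omega>
    using Suc(4)[OF that] N_mono[OF that(1), of t 1] t by auto
  have Y_hist: "Y \<in> borel_measurable (hist n)" by (rule past_hist[OF _ Suc(2)]) (use t in auto)
  have "N u \<in> hist n \<rightarrow>\<^sub>M count_space UNIV" "N t \<in> hist n \<rightarrow>\<^sub>M count_space UNIV"
    using N_hist t by auto
  then have D_hist: "?D \<in> borel_measurable (hist n)" by measurable
  (* Y' is still determined by the counts up to time t, so the induction hypothesis applies to it. *)
  define Y' where "Y' B p \<omega> = swap_prob B p (if n < N t \<omega> then etime n \<omega> else 1) * Y \<omega>" for B p \<omega>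
  have Y': "(\<integral>\<omega>. indicator {B} (cur n \<omega>) * (swap_prob B p (etime n \<omega>) * (Y \<omega> * D \<omega>)) \<partial>M) =
      (\<integral>\<omega>. indicator {B} (cur n \<omega>) * (Y' B p \<omega> * D \<omega>) \<partial>M)" for B p D
    using N1(2) by (intro Bochner_Integration.integral_cong refl) (auto simp: Y'_def)
  have IH: "(\<integral>\<omega>. indicator {B} (cur n \<omega>) * (Y' B p \<omega> * ?D \<omega>) \<partial>M) =
      (\<integral>\<omega>. indicator {B} (cur n \<omega>) * Y' B p \<omega> \<partial>M) * ?P"
    if "B \<in> bases Ind" "p \<in> U \<times> U" for B p
  proof (rule Suc.IH)
    have "(\<lambda>\<omega>. if n < N t \<omega> then etime n \<omega> else 1) \<in> borel_measurable (past t)"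
      by (rule measurable_event_time) (use measurable_past t in auto)
    then show "Y' B p \<in> borel_measurable (past t)"
      unfolding Y'_def[abs_def]
      by (intro borel_measurable_times measurable_compose[OF _ swap_prob_measurable[OF that]] Suc(2))
    fix \<omega> assume \<omega>: "\<omega> \<in> space M"
    have "\<bar>Y' B p \<omega>\<bar> = swap_prob B p (if n < N t \<omega> then etime n \<omega> else 1) * \<bar>Y \<omega>\<bar>"
      using swap_prob_bounds by (simp add: Y'_def abs_mult)
    also have "\<dots> \<le> 1 * c"
      using Suc(3)[OF \<omega>] swap_prob_bounds by (intro mult_mono) auto
    finally show "\<bar>Y' B p \<omega>\<bar> \<le> c" by simp
    show "n \<le> N t \<omega>" if "Y' B p \<omega> \<noteq> 0"
      using N1(2)[OF \<omega>] that by (auto simp: Y'_def)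
  qed
  let ?\<phi> = "\<lambda>B p. indicator {A} (apply_swap B p) :: real"
  have "(\<integral>\<omega>. indicator {A} (cur (Suc n) \<omega>) * (Y \<omega> * ?D \<omega>) \<partial>M) =
      (\<Sum>B\<in>bases Ind. \<Sum>p\<in>U \<times> U. ?\<phi> B p *
        (\<integral>\<omega>. indicator {B} (cur n \<omega>) * (swap_prob B p (etime n \<omega>) * (Y \<omega> * ?D \<omega>)) \<partial>M))"
    unfolding current_set.simps
  proof (rule cur_Suc_expectation[where c=c])
    show "(\<lambda>\<omega>. Y \<omega> * ?D \<omega>) \<in> borel_measurable (hist n)"
      by (intro borel_measurable_times Y_hist D_hist)
    show "\<bar>Y \<omega> * ?D \<omega>\<bar> \<le> c" if "\<omega> \<in> space M" for \<omega>
      using Suc(3)[OF that] by (auto simp: indicator_def)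
  qed (use N1 in auto)
  \<comment> \<open>The factor \<open>1\<close> lets the rewrite rule \<open>Y'\<close> act on the
    integral without the increment as well.\<close>
  also have "\<dots> = (\<Sum>B\<in>bases Ind. \<Sum>p\<in>U \<times> U. ?\<phi> B p *
        (\<integral>\<omega>. indicator {B} (cur n \<omega>) * (swap_prob B p (etime n \<omega>) * (Y \<omega> * 1)) \<partial>M)) * ?P"
    unfolding Y' sum_distrib_right by (intro sum.cong refl) (simp add: IH)
  also have "(\<Sum>B\<in>bases Ind. \<Sum>p\<in>U \<times> U. ?\<phi> B p *
        (\<integral>\<omega>. indicator {B} (cur n \<omega>) * (swap_prob B p (etime n \<omega>) * (Y \<omega> * 1)) \<partial>M)) =
      (\<integral>\<omega>. indicator {A} (cur (Suc n) \<omega>) * Y \<omega> \<partial>M)"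
    unfolding current_set.simps mult_1_right
    by (rule cur_Suc_expectation[OF Y_hist Suc(3) N1(1), symmetric])
  finally show ?case .
qed

lemma bounded_on_sets:
  obtains c where "\<And>A. A \<subseteq> U \<Longrightarrow> \<bar>\<phi> A :: real\<bar> \<le> c" "0 \<le> c"
proof
  show "\<bar>\<phi> A\<bar> \<le> (\<Sum>B\<in>Pow U. \<bar>\<phi> B\<bar>)" if "A \<subseteq> U" for A
    using that finite_ground by (intro member_le_sum) auto
qed (auto intro: sum_nonneg)

lemma cur_at_measurable:
  assumes "t \<in> {\<epsilon>..1}"
  shows "(\<lambda>\<omega>. cur (N t \<omega> + m) \<omega>) \<in> M \<rightarrow>\<^sub>M count_space UNIV"
  by (rule measurable_compose_countable[where g="N t"]) (use cur_measurable N_measurable assms in auto)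

text \<open>The index \<open>N t\<close> of the current set is random, while the induction treats a
  fixed number of calls; expectations are therefore split by the value of \<open>N t\<close>, using
  dominated convergence.\<close>

lemma integral_sums_count:
  assumes t: "t \<in> {\<epsilon>..1}" and V: "V \<in> borel_measurable M" "\<And>\<omega>. \<omega> \<in> space M \<Longrightarrow> \<bar>V \<omega>\<bar> \<le> (c :: real)"
  shows "(\<lambda>n. \<integral>\<omega>. V \<omega> * indicator {n} (N t \<omega>) \<partial>M) sums (\<integral>\<omega>. V \<omega> \<partial>M)"
proof -
  note [measurable] = V(1) borel_measurable_of_count[OF N_measurable[OF t]]
  have V0: "0 \<le> c" using V(2) not_empty by force
  have "(\<lambda>m. \<integral>\<omega>. (\<Sum>n<m. V \<omega> * indicator {n} (N t \<omega>)) \<partial>M) \<longlonglongrightarrow> (\<integral>\<omega>. V \<omega> \<partial>M)"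
  proof (rule integral_dominated_convergence[where w="\<lambda>_. c"])
    have eq: "(\<Sum>n<m. V \<omega> * indicator {n} (N t \<omega>)) = (if N t \<omega> < m then V \<omega> else 0)" for m \<omega>
    proof -
      have "(\<Sum>n<m. V \<omega> * indicator {n} (N t \<omega>)) = (\<Sum>n<m. if n = N t \<omega> then V \<omega> else 0)"
        by (intro sum.cong) (auto simp: indicator_def)
      then show ?thesis by simp
    qed
    show "AE \<omega> in M. (\<lambda>m. \<Sum>n<m. V \<omega> * indicator {n} (N t \<omega>)) \<longlonglongrightarrow> V \<omega>"
    proof (intro AE_I2 tendsto_eventually)
      fix \<omega>
      show "\<forall>\<^sub>F m in sequentially. (\<Sum>n<m. V \<omega> * indicator {n} (N t \<omega>)) = V \<omega>"
        unfolding eq using eventually_gt_at_top[of "N t \<omega>"] by (rule eventually_mono) simp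
    qed
    show "AE \<omega> in M. norm (\<Sum>n<m. V \<omega> * indicator {n} (N t \<omega>)) \<le> c" for m
      unfolding eq using V(2) V0 by (intro AE_I2) auto
  qed measurable
  moreover have "(\<integral>\<omega>. (\<Sum>n<m. V \<omega> * indicator {n} (N t \<omega>)) \<partial>M) =
      (\<Sum>n<m. \<integral>\<omega>. V \<omega> * indicator {n} (N t \<omega>) \<partial>M)" for m
  proof (rule Bochner_Integration.integral_sum)
    show "integrable M (\<lambda>\<omega>. V \<omega> * indicator {n} (N t \<omega>))" for n
    proof (rule integrable_bounded)
      show "\<bar>V \<omega> * indicator {n} (N t \<omega>)\<bar> \<le> c" if "\<omega> \<in> space M" for \<omega>
        using V(2)[OF that] V0 by (auto simp: indicator_def)
    qed measurable
  qed
  ultimately show ?thesis unfolding sums_def by simp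
qed

text \<open>Where \<open>N t \<omega> = n\<close> the current set is \<open>cur n \<omega>\<close>,
  and the indicator of this event depends on the past only, so it can serve as the weight
  \<open>Y\<close> in \<open>past_current_indep\<close>.\<close>

lemma current_set_increment_indep:
  assumes t: "t \<in> {\<epsilon>..1}" "u \<in> {t..1}"
  shows "(\<integral>\<omega>. \<phi> (cur (N t \<omega>) \<omega>) * indicator {d} (N u \<omega> - N t \<omega>) \<partial>M) =
    (\<integral>\<omega>. (\<phi> (cur (N t \<omega>) \<omega>) :: real) \<partial>M) * prob {\<omega> \<in> space M. N u \<omega> - N t \<omega> = d}"
    (is "(\<integral>\<omega>. ?X \<omega> * ?D \<omega> \<partial>M) = _ * ?P")
proof -
  obtain c where c: "\<And>A. A \<subseteq> U \<Longrightarrow> \<bar>\<phi> A\<bar> \<le> c" "0 \<le> c" using bounded_on_sets by blast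
  have N: "N u \<in> M \<rightarrow>\<^sub>M count_space UNIV" "N t \<in> M \<rightarrow>\<^sub>M count_space UNIV"
    using N_measurable t by auto
  then have D[measurable]: "?D \<in> borel_measurable M" by measurable
  have X[measurable]: "?X \<in> borel_measurable M"
    using borel_measurable_of_count[OF cur_at_measurable[OF t(1), of 0]] by simp
  note [measurable] = borel_measurable_of_count[OF N(2)] borel_measurable_of_count[OF cur_measurable]
  have s1: "(\<lambda>n. \<integral>\<omega>. (?X \<omega> * ?D \<omega>) * indicator {n} (N t \<omega>) \<partial>M) sums (\<integral>\<omega>. ?X \<omega> * ?D \<omega> \<partial>M)"
    by (rule integral_sums_count[OF t(1), where c=c], measurable)
      (use c cur_subset in \<open>auto simp: indicator_def\<close>)
  have s2: "(\<lambda>n. (\<integral>\<omega>. ?X \<omega> * indicator {n} (N t \<omega>) \<partial>M) * ?P) sums ((\<integral>\<omega>. ?X \<omega> \<partial>M) * ?P)"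
    by (intro sums_mult2 integral_sums_count[OF t(1), where c=c])
      (use c cur_subset in \<open>auto simp: indicator_def\<close>)
  \<comment> \<open>Used with \<open>D\<close> the indicator of the increment and with
    \<open>D\<close> constantly \<open>1\<close>, for the two sides of the product formula.\<close>
  have eq: "(\<integral>\<omega>. (?X \<omega> * D \<omega>) * indicator {n} (N t \<omega>) \<partial>M) =
      (\<Sum>A\<in>Pow U. \<phi> A * (\<integral>\<omega>. indicator {A} (cur n \<omega>) * (indicator {n} (N t \<omega>) * D \<omega>) \<partial>M))"
    if D: "D \<in> borel_measurable M" "\<And>\<omega>. \<bar>D \<omega>\<bar> \<le> 1" for n D
  proof -
    note [measurable] = D(1)
    have "(\<integral>\<omega>. (?X \<omega> * D \<omega>) * indicator {n} (N t \<omega>) \<partial>M) =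
      (\<integral>\<omega>. (\<Sum>A\<in>Pow U. \<phi> A * (indicator {A} (cur n \<omega>) * (indicator {n} (N t \<omega>) * D \<omega>))) \<partial>M)"
    proof (intro Bochner_Integration.integral_cong refl)
      fix \<omega> assume \<omega>: "\<omega> \<in> space M"
      have "(?X \<omega> * D \<omega>) * indicator {n} (N t \<omega>) = \<phi> (cur n \<omega>) * (indicator {n} (N t \<omega>) * D \<omega>)"
        by (auto simp: indicator_def)
      also have "\<dots> = (\<Sum>A\<in>Pow U. \<phi> A * (indicator {n} (N t \<omega>) * D \<omega>) * indicator {A} (cur n \<omega>))"
        by (rule sum_indicator_singleton[symmetric]) (use finite_ground cur_subset[OF \<omega>] in auto)
      finally show "(?X \<omega> * D \<omega>) * indicator {n} (N t \<omega>) =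
          (\<Sum>A\<in>Pow U. \<phi> A * (indicator {A} (cur n \<omega>) * (indicator {n} (N t \<omega>) * D \<omega>)))"
        by (simp add: mult_ac)
    qed
    also have "\<dots> = (\<Sum>A\<in>Pow U. \<integral>\<omega>. \<phi> A * (indicator {A} (cur n \<omega>) * (indicator {n} (N t \<omega>) * D \<omega>)) \<partial>M)"
    proof (rule Bochner_Integration.integral_sum, intro integrable_mult_right)
      show "integrable M (\<lambda>\<omega>. indicator {A} (cur n \<omega>) * (indicator {n} (N t \<omega>) * D \<omega>))" for A
        by (rule integrable_bounded[where c=1], measurable) (use D(2) in \<open>auto simp: indicator_def\<close>)
    qed
    finally show ?thesis by simp
  qed
  have "(\<integral>\<omega>. (?X \<omega> * ?D \<omega>) * indicator {n} (N t \<omega>) \<partial>M) =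
      (\<integral>\<omega>. (?X \<omega> * 1) * indicator {n} (N t \<omega>) \<partial>M) * ?P" for n
  proof -
    have "(\<integral>\<omega>. indicator {A} (cur n \<omega>) * (indicator {n} (N t \<omega>) * ?D \<omega>) \<partial>M) =
      (\<integral>\<omega>. indicator {A} (cur n \<omega>) * (indicator {n} (N t \<omega>) * 1) \<partial>M) * ?P" for A
      unfolding mult_1_right
      by (rule past_current_indep[OF t, where c=1])
        (use t in \<open>auto simp: indicator_def split: if_splits intro: borel_measurable_of_count[OF measurable_past]\<close>)
    then show ?thesis
      using eq[of ?D n] eq[of "\<lambda>_. 1" n] D
      by (simp add: sum_distrib_right mult.assoc)
  qed
  then have "(\<lambda>n. \<integral>\<omega>. (?X \<omega> * ?D \<omega>) * indicator {n} (N t \<omega>) \<partial>M) sums ((\<integral>\<omega>. ?X \<omega> \<partial>M) * ?P)"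
    using s2 by simp
  with s1 show ?thesis by (rule sums_unique2)
qed

text \<open>With exactly one event in the step, its time is random but lies in
  \<open>{t..u}\<close>. As \<open>\<psi>\<close> is a lower bound at every such time, the event
  time disappears from the estimate, and independence of the increment then factors the
  expectation.\<close>

lemma single_event_expectation_ge:
  assumes t: "t \<in> {\<epsilon>..1}" "u \<in> {t..1}"
    and drift: "\<And>A s. A \<in> bases Ind \<Longrightarrow> s \<in> {t..u} \<Longrightarrow>
      \<psi> A \<le> (\<Sum>p\<in>U \<times> U. swap_prob A p s * \<phi> (apply_swap A p))"
  shows "(\<integral>\<omega>. (\<psi> (cur (N t \<omega>) \<omega>) :: real) \<partial>M) * prob {\<omega> \<in> space M. N u \<omega> - N t \<omega> = 1} \<le>
    (\<integral>\<omega>. \<phi> (cur (N t \<omega> + 1) \<omega>) * indicator {1} (N u \<omega> - N t \<omega>) \<partial>M)"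
    (is "_ \<le> (\<integral>\<omega>. ?X \<omega> * ?D \<omega> \<partial>M)")
proof -
  obtain c where c: "\<And>A. A \<subseteq> U \<Longrightarrow> \<bar>\<phi> A\<bar> \<le> c" "0 \<le> c" using bounded_on_sets by blast
  obtain c' where c': "\<And>A. A \<subseteq> U \<Longrightarrow> \<bar>\<psi> A\<bar> \<le> c'" "0 \<le> c'" using bounded_on_sets by blast
  let ?Y = "\<lambda>\<omega>. \<psi> (cur (N t \<omega>) \<omega>)"
  have N: "N u \<in> M \<rightarrow>\<^sub>M count_space UNIV" "N t \<in> M \<rightarrow>\<^sub>M count_space UNIV"
    using N_measurable t by auto
  then have [measurable]: "?D \<in> borel_measurable M" by measurable
  have X[measurable]: "?X \<in> borel_measurable M"
    by (rule borel_measurable_of_count[OF cur_at_measurable[OF t(1)]])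
  have Y[measurable]: "?Y \<in> borel_measurable M"
    using borel_measurable_of_count[OF cur_at_measurable[OF t(1), of 0]] by simp
  note [measurable] = borel_measurable_of_count[OF N(2)] borel_measurable_of_count[OF cur_measurable]
  have s1: "(\<lambda>n. \<integral>\<omega>. (?X \<omega> * ?D \<omega>) * indicator {n} (N t \<omega>) \<partial>M) sums (\<integral>\<omega>. ?X \<omega> * ?D \<omega> \<partial>M)"
    by (rule integral_sums_count[OF t(1), where c=c], measurable)
      (use c cur_subset[of _ "Suc _"] in \<open>auto simp: indicator_def simp del: current_set.simps\<close>)
  have s2: "(\<lambda>n. \<integral>\<omega>. (?Y \<omega> * ?D \<omega>) * indicator {n} (N t \<omega>) \<partial>M) sums (\<integral>\<omega>. ?Y \<omega> * ?D \<omega> \<partial>M)"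
    by (rule integral_sums_count[OF t(1), where c=c'], measurable)
      (use c' cur_subset in \<open>auto simp: indicator_def\<close>)
  have "(\<integral>\<omega>. (?Y \<omega> * ?D \<omega>) * indicator {n} (N t \<omega>) \<partial>M) \<le>
      (\<integral>\<omega>. (?X \<omega> * ?D \<omega>) * indicator {n} (N t \<omega>) \<partial>M)" for n
  proof -
    \<comment> \<open>\<open>?Z\<close> looks beyond time \<open>t\<close>, but it depends on the
      event process alone and so is measurable with respect to \<open>hist n\<close>.\<close>
    let ?Z = "\<lambda>\<omega>. indicator {n} (N t \<omega>) * ?D \<omega>"
    have Zh: "?Z \<in> borel_measurable (hist n)"
    proof -
      have "N u \<in> hist n \<rightarrow>\<^sub>M count_space UNIV" "N t \<in> hist n \<rightarrow>\<^sub>M count_space UNIV"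
        using N_hist t by auto
      then have "?D \<in> borel_measurable (hist n)" by measurable
      then show ?thesis
        using N_hist t by (intro borel_measurable_times borel_measurable_of_count) auto
    qed
    have Z01: "0 \<le> ?Z \<omega>" "\<bar>?Z \<omega>\<bar> \<le> 1" for \<omega> by (auto simp: indicator_def)
    have Znz: "N t \<omega> = n \<and> n < N u \<omega> \<and> n < N 1 \<omega>" if "\<omega> \<in> space M" "?Z \<omega> \<noteq> 0" for \<omega>
      using that N_mono[OF that(1), of u 1] t by (auto simp: indicator_def split: if_splits)
    \<comment> \<open>Numbering starts at \<open>0\<close>: \<open>N t \<omega> = n\<close> places
      event \<open>n\<close> after \<open>t\<close>, and \<open>n < N u \<omega>\<close> places it
      no later than \<open>u\<close>.\<close>
    have Zu: "etime n \<omega> \<in> {t..u}" if \<omega>: "\<omega> \<in> space M" "?Z \<omega> \<noteq> 0" for \<omega>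
      using Znz[OF \<omega>] event_time_le_iff[OF \<omega>(1), of n t] event_time_le_iff[OF \<omega>(1), of n u] t
      by auto
    have swp: "(\<lambda>\<omega>. swap_prob A p (etime n \<omega>) * ?Z \<omega>) \<in> borel_measurable M"
      if "A \<in> bases Ind" "p \<in> U \<times> U" for A p
    proof -
      have meas: "(\<lambda>\<omega>. swap_prob A p (if n < N 1 \<omega> then etime n \<omega> else 1) * ?Z \<omega>) \<in> borel_measurable M"
        by (intro borel_measurable_times hist_measurable[OF Zh]
            measurable_compose[OF event_time_measurable swap_prob_measurable[OF that]])
      have cong: "swap_prob A p (if n < N 1 \<omega> then etime n \<omega> else 1) * ?Z \<omega> =
          swap_prob A p (etime n \<omega>) * ?Z \<omega>" if "\<omega> \<in> space M" for \<omega>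
      proof (cases "?Z \<omega> = 0")
        case False
        then have "n < N 1 \<omega>" using Znz[OF that] by blast
        then show ?thesis by (simp only: if_True)
      qed (simp only: mult_zero_right)
      show ?thesis by (rule iffD1[OF measurable_cong[OF cong] meas])
    qed
    have iZ: "integrable M (\<lambda>\<omega>. indicator {A} (cur n \<omega>) * ?Z \<omega>)" for A
      by (rule integrable_bounded[where c=1], measurable) (auto simp: indicator_def)
    have iS: "integrable M (\<lambda>\<omega>. indicator {A} (cur n \<omega>) * (swap_prob A p (etime n \<omega>) * ?Z \<omega>))"
      if "A \<in> bases Ind" "p \<in> U \<times> U" for A p
    proof (rule integrable_bounded[where c=1])
      show "(\<lambda>\<omega>. indicator {A} (cur n \<omega>) * (swap_prob A p (etime n \<omega>) * ?Z \<omega>)) \<in> borel_measurable M"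
        by (intro borel_measurable_times[OF _ swp[OF that]] borel_measurable_of_count cur_measurable)
      show "\<bar>indicator {A} (cur n \<omega>) * (swap_prob A p (etime n \<omega>) * ?Z \<omega>)\<bar> \<le> 1" for \<omega>
        using swap_prob_bounds[of A p "etime n \<omega>"] by (auto simp: indicator_def)
    qed
    have "(\<integral>\<omega>. (?Y \<omega> * ?D \<omega>) * indicator {n} (N t \<omega>) \<partial>M) =
      (\<integral>\<omega>. (\<Sum>A\<in>bases Ind. \<psi> A * (indicator {A} (cur n \<omega>) * ?Z \<omega>)) \<partial>M)"
    proof (rule integral_cong_AE)
      show "AE \<omega> in M. (?Y \<omega> * ?D \<omega>) * indicator {n} (N t \<omega>) =
          (\<Sum>A\<in>bases Ind. \<psi> A * (indicator {A} (cur n \<omega>) * ?Z \<omega>))"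
        using AE_cur_base[of n] AE_space
      proof eventually_elim
        case (elim \<omega>)
        show ?case
        proof (cases "?Z \<omega> = 0")
          case False
          note z = Znz[OF elim(2) this]
          have Nt: "N t \<omega> = n" by (rule conjunct1[OF z])
          have "n \<le> N 1 \<omega>" by (rule less_imp_le[OF conjunct2[OF conjunct2[OF z]]])
          then have base: "cur n \<omega> \<in> bases Ind" using elim(1) by blast
          have "(?Y \<omega> * ?D \<omega>) * indicator {n} (N t \<omega>) = \<psi> (cur n \<omega>) * ?Z \<omega>"
            by (simp add: Nt)
          also have "\<dots> = (\<Sum>A\<in>bases Ind. \<psi> A * ?Z \<omega> * indicator {A} (cur n \<omega>))"
            by (rule sum_indicator_singleton[symmetric]) (use finite_bases base in auto)
          finally show ?thesis by (simp add: mult_ac)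
        next
          case True
          have "(?Y \<omega> * ?D \<omega>) * indicator {n} (N t \<omega>) = ?Y \<omega> * ?Z \<omega>" by simp
          then show ?thesis unfolding True by simp
        qed
      qed
    qed measurable
    also have "\<dots> = (\<Sum>A\<in>bases Ind. \<integral>\<omega>. \<psi> A * (indicator {A} (cur n \<omega>) * ?Z \<omega>) \<partial>M)"
      by (rule Bochner_Integration.integral_sum) (intro integrable_mult_right iZ)
    also have "\<dots> = (\<Sum>A\<in>bases Ind. \<integral>\<omega>. indicator {A} (cur n \<omega>) * (\<psi> A * ?Z \<omega>) \<partial>M)"
      by (intro sum.cong Bochner_Integration.integral_cong refl) (rule mult.left_commute)
    also have "\<dots> \<le> (\<Sum>A\<in>bases Ind. \<integral>\<omega>. (\<Sum>p\<in>U \<times> U. \<phi> (apply_swap A p) *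
        (indicator {A} (cur n \<omega>) * (swap_prob A p (etime n \<omega>) * ?Z \<omega>))) \<partial>M)"
    proof (intro sum_mono integral_mono)
      fix A assume A: "A \<in> bases Ind"
      show "integrable M (\<lambda>\<omega>. indicator {A} (cur n \<omega>) * (\<psi> A * ?Z \<omega>))"
        using integrable_mult_right[OF iZ, of "\<psi> A" A] by (simp add: mult_ac)
      show "integrable M (\<lambda>\<omega>. \<Sum>p\<in>U \<times> U. \<phi> (apply_swap A p) *
        (indicator {A} (cur n \<omega>) * (swap_prob A p (etime n \<omega>) * ?Z \<omega>)))"
        by (intro Bochner_Integration.integrable_sum integrable_mult_right iS A)
      fix \<omega> assume \<omega>: "\<omega> \<in> space M"
      show "indicator {A} (cur n \<omega>) * (\<psi> A * ?Z \<omega>) \<le> (\<Sum>p\<in>U \<times> U. \<phi> (apply_swap A p) *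
        (indicator {A} (cur n \<omega>) * (swap_prob A p (etime n \<omega>) * ?Z \<omega>)))"
      proof (cases "?Z \<omega> = 0")
        case False
        have "\<psi> A * (indicator {A} (cur n \<omega>) * ?Z \<omega>) \<le>
          (\<Sum>p\<in>U \<times> U. swap_prob A p (etime n \<omega>) * \<phi> (apply_swap A p)) * (indicator {A} (cur n \<omega>) * ?Z \<omega>)"
          using drift[OF A Zu[OF \<omega> False]] Z01 by (intro mult_right_mono) auto
        then show ?thesis by (simp add: sum_distrib_left sum_distrib_right mult_ac)
      next
        case True
        show ?thesis unfolding True by simp
      qed
    qed
    also have "\<dots> = (\<Sum>A\<in>bases Ind. \<Sum>p\<in>U \<times> U. \<phi> (apply_swap A p) *
        (\<integral>\<omega>. indicator {A} (cur n \<omega>) * (swap_prob A p (etime n \<omega>) * ?Z \<omega>) \<partial>M))"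
    proof (rule sum.cong[OF refl])
      fix A assume A: "A \<in> bases Ind"
      show "(\<integral>\<omega>. (\<Sum>p\<in>U \<times> U. \<phi> (apply_swap A p) *
          (indicator {A} (cur n \<omega>) * (swap_prob A p (etime n \<omega>) * ?Z \<omega>))) \<partial>M) =
        (\<Sum>p\<in>U \<times> U. \<phi> (apply_swap A p) *
          (\<integral>\<omega>. indicator {A} (cur n \<omega>) * (swap_prob A p (etime n \<omega>) * ?Z \<omega>) \<partial>M))"
        by (subst Bochner_Integration.integral_sum) (intro integrable_mult_right iS A, assumption, simp)
    qed
    also have "\<dots> = (\<integral>\<omega>. \<phi> (apply_swap (cur n \<omega>) (S n \<omega>)) * ?Z \<omega> \<partial>M)"
      by (rule cur_Suc_expectation[where \<phi>="\<lambda>B p. \<phi> (apply_swap B p)" and c=1, OF Zh, symmetric])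
        (use Z01 Znz in blast)+
    also have "\<dots> = (\<integral>\<omega>. (?X \<omega> * ?D \<omega>) * indicator {n} (N t \<omega>) \<partial>M)"
      by (intro Bochner_Integration.integral_cong) (auto simp: indicator_def)
    finally show ?thesis .
  qed
  then have "(\<integral>\<omega>. ?Y \<omega> * ?D \<omega> \<partial>M) \<le> (\<integral>\<omega>. ?X \<omega> * ?D \<omega> \<partial>M)"
    using s2 s1 by (rule sums_le)
  then show ?thesis using current_set_increment_indep[OF t, of \<psi> 1] by simp
qed

end

section \<open>Growth of the potential\<close>

lemma sums_poisson_mean:
  fixes l :: real
  shows "(\<lambda>n. real n * (l ^ n / fact n * exp (- l))) sums l"
proof -
  have "(\<lambda>n. l * exp (- l) * (l ^ n /\<^sub>R fact n)) sums (l * exp (- l) * exp l)"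
    by (intro sums_mult exp_converges)
  moreover have "l * exp (- l) * (l ^ n /\<^sub>R fact n) =
      real (Suc n) * (l ^ Suc n / fact (Suc n) * exp (- l))" for n
    by (simp add: divide_simps)
  ultimately have "(\<lambda>n. real (Suc n) * (l ^ Suc n / fact (Suc n) * exp (- l))) sums l"
    by (simp add: exp_minus mult.assoc del: fact_Suc power_Suc of_nat_Suc)
  then show ?thesis by (subst (asm) sums_Suc_iff) simp
qed

text \<open>A single step width that works for every member of the family, so that the error of a
  step is controlled uniformly in the base and the time.\<close>

lemma uniform_modulus:
  fixes q :: "'i \<Rightarrow> real \<Rightarrow> real"
  assumes "finite I" "\<And>i. i \<in> I \<Longrightarrow> continuous_on {0..1} (q i)" "0 < \<delta>"
  obtains h where "0 < h"
    "\<And>i s t. i \<in> I \<Longrightarrow> s \<in> {0..1} \<Longrightarrow> t \<in> {0..1} \<Longrightarrow> \<bar>s - t\<bar> \<le> h \<Longrightarrow> \<bar>q i s - q i t\<bar> \<le> \<delta>"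
proof -
  have "\<exists>h>0. \<forall>i\<in>I. \<forall>s\<in>{0..1}. \<forall>t\<in>{0..1}. \<bar>s - t\<bar> \<le> h \<longrightarrow> \<bar>q i s - q i t\<bar> \<le> \<delta>"
    using assms(1,2)
  proof (induction I rule: finite_induct)
    case empty
    then show ?case by (intro exI[of _ 1]) auto
  next
    case (insert i I)
    then obtain h where h: "h > 0" "\<forall>i\<in>I. \<forall>s\<in>{0..1}. \<forall>t\<in>{0..1}. \<bar>s - t\<bar> \<le> h \<longrightarrow> \<bar>q i s - q i t\<bar> \<le> \<delta>"
      by auto
    have "uniformly_continuous_on {0..1} (q i)"
      using insert by (intro compact_uniformly_continuous) auto
    then obtain d where d: "d > 0" "\<And>s t. s \<in> {0..1} \<Longrightarrow> t \<in> {0..1} \<Longrightarrow> dist s t < d \<Longrightarrow> dist (q i s) (q i t) < \<delta>"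
      unfolding uniformly_continuous_on_def using assms(3) by meson
    have "\<bar>q j s - q j t\<bar> \<le> \<delta>"
      if "j \<in> insert i I" "s \<in> {0..1}" "t \<in> {0..1}" "\<bar>s - t\<bar> \<le> min h (d / 2)" for j s t
    proof (cases "j = i")
      case True
      then show ?thesis using d(1) d(2)[of s t] that by (simp add: dist_real_def)
    next
      case False
      then show ?thesis using h(2) that by auto
    qed
    then show ?case using h(1) d(1) by (intro exI[of _ "min h (d / 2)"]) auto
  qed
  then show thesis using that by blast
qed

text \<open>Here \<open>l\<close> is the expected number of events in a step of length \<open>h\<close>, and \<open>exp (- l)\<close> and
  \<open>l * exp (- l)\<close> are the probabilities of no event and of exactly one.\<close>

lemma poisson_step_bound:
  fixes k \<epsilon> t h \<delta> q a g B :: real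
  assumes k: "0 < k" and eps: "0 < \<epsilon>" "\<epsilon> \<le> t" and h: "0 < h" "h \<le> \<epsilon>" and \<delta>: "0 \<le> \<delta>"
    and q: "\<bar>q\<bar> \<le> B" and a: "0 \<le> a" "a \<le> B" and g: "0 \<le> g" "g \<le> B"
    and l: "l = k * ln ((t + h) / t)"
  shows "g + h * (a + q) - h * (\<delta> * (1 + k / \<epsilon>) + h * (B * ((2 * k + 1) / \<epsilon> + k\<^sup>2 / \<epsilon>\<^sup>2)))
    \<le> exp (- l) * (g + h * (a - \<delta>)) + l * exp (- l) * (g + t / k * q - \<delta>)"
proof -
  have t: "0 < t" using eps by simp
  have B: "0 \<le> B" using g by simp
  have ht: "0 < h / t" "h / t \<le> h / \<epsilon>" "h / t \<le> 1"
    using t h eps by (auto simp: divide_simps intro: mult_left_mono)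
  have eq: "(t + h) / t = 1 + h / t" using t by (simp add: add_divide_distrib)
  have l0: "0 \<le> l" using k ht by (simp add: l eq)
  have "l \<le> k * (h / t)"
    unfolding l eq using k ht by (intro mult_left_mono ln_add_one_self_le_self) auto
  then have l1: "l * t \<le> k * h" using t by (simp add: field_simps)
  have "l \<le> k * (h / \<epsilon>)"
    using \<open>l \<le> k * (h / t)\<close> mult_left_mono[OF ht(2), of k] k by linarith
  then have l2: "l \<le> h * (k / \<epsilon>)" by (simp add: field_simps)
  \<comment> \<open>By \<open>x - x\<^sup>2 \<le> ln (1 + x) \<le> x\<close> for
    \<open>x = h / t\<close>, the number \<open>t / k * l\<close> equals \<open>h\<close> up to
    \<open>h\<^sup>2 / \<epsilon>\<close>: the rate \<open>k / t\<close> cancels the factor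
    \<open>t / k\<close> of the swap gain.\<close>
  have "k * (h / t - (h / t)\<^sup>2) \<le> l"
    unfolding l eq using k ht by (intro mult_left_mono ln_one_plus_pos_lower_bound) auto
  then have "t / k * (k * (h / t - (h / t)\<^sup>2)) \<le> t / k * l"
    using k t by (intro mult_left_mono) auto
  moreover have "t / k * (k * (h / t - (h / t)\<^sup>2)) = h - h * (h / t)"
    using k t by (simp add: field_simps power2_eq_square)
  moreover have "h * (h / t) \<le> h * (h / \<epsilon>)" using ht h by (intro mult_left_mono) auto
  ultimately have l3: "h - h * (h / \<epsilon>) \<le> t / k * l" by linarith
  have l4: "t / k * l \<le> h" using l1 k by (simp add: field_simps)
  define P0 P1 where "P0 = exp (- l)" and "P1 = l * exp (- l)"
  have P0: "1 - l \<le> P0" "P0 \<le> 1" using exp_ge_add_one_self[of "- l"] l0 by (auto simp: P0_def)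
  have P1: "l - l * l \<le> P1" "P1 \<le> l"
    using mult_left_mono[OF P0(1) l0] mult_left_mono[OF P0(2) l0]
    by (auto simp: P0_def P1_def right_diff_distrib)
  have "P0 * (h * a) \<ge> (1 - l) * (h * a)" using P0 a h by (intro mult_right_mono) auto
  moreover have "l * (h * a) \<le> h * (k / \<epsilon>) * (h * B)"
    using l2 l0 a h k eps B by (intro mult_mono) auto
  ultimately have A: "P0 * (h * a) \<ge> h * a - h * (k / \<epsilon>) * (h * B)"
    by (simp add: left_diff_distrib)
  have "P0 * (h * \<delta>) \<le> 1 * (h * \<delta>)" using P0 h \<delta> by (intro mult_right_mono) auto
  then have A': "P0 * (h * (a - \<delta>)) \<ge> h * a - h * (k / \<epsilon>) * (h * B) - h * \<delta>"
    using A by (simp add: algebra_simps)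
  have "t / k * P1 \<le> t / k * l" using P1 t k by (intro mult_left_mono) auto
  then have r1: "t / k * P1 \<le> h" using l4 by simp
  have "t / k * (l - l * l) \<le> t / k * P1" using P1 t k by (intro mult_left_mono) auto
  moreover have "t / k * (l - l * l) = t / k * l - l * (t / k * l)" by (simp add: algebra_simps)
  moreover have "l * (t / k * l) \<le> h * (k / \<epsilon>) * h"
    using l0 l2 l4 k t eps h by (intro mult_mono) auto
  ultimately have r2: "t / k * P1 \<ge> h - h * (h / \<epsilon>) - h * (k / \<epsilon>) * h" using l3 by linarith
  define e where "e = h * (h / \<epsilon>) + h * (k / \<epsilon>) * h"
  have "\<bar>t / k * P1 - h\<bar> \<le> e" using r1 r2 h k eps unfolding e_def by (auto simp: abs_le_iff)
  then have "\<bar>(t / k * P1 - h) * q\<bar> \<le> e * B"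
    unfolding abs_mult using q h k eps by (intro mult_mono) (auto simp: e_def)
  then have C: "P1 * (t / k * q) \<ge> h * q - e * B" by (simp add: algebra_simps abs_le_iff)
  have D: "P1 * \<delta> \<le> h * (k / \<epsilon>) * \<delta>" using P1 l2 \<delta> by (intro mult_right_mono) auto
  \<comment> \<open>Two or more events have probability at most \<open>l * l\<close>, so leaving
    them out costs at most \<open>l * l * g\<close>.\<close>
  have "1 - P0 - P1 \<le> l * l" using P0 P1 by linarith
  then have "(1 - P0 - P1) * g \<le> l * l * g" using g by (intro mult_right_mono) auto
  also have "\<dots> \<le> (h * (k / \<epsilon>)) * (h * (k / \<epsilon>)) * B"
    using l0 l2 g h k eps by (intro mult_mono) auto
  finally have E: "P0 * g + P1 * g \<ge> g - (h * (k / \<epsilon>)) * (h * (k / \<epsilon>)) * B" by (simp add: algebra_simps)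
  have rhs: "exp (- l) * (g + h * (a - \<delta>)) + l * exp (- l) * (g + t / k * q - \<delta>) =
      (P0 * g + P1 * g) + P0 * (h * (a - \<delta>)) + P1 * (t / k * q) - P1 * \<delta>"
    by (simp add: P0_def P1_def algebra_simps)
  \<comment> \<open>The errors add up: \<open>A'\<close> gives \<open>k / \<epsilon>\<close>,
    \<open>C\<close> gives \<open>(1 + k) / \<epsilon>\<close> and \<open>E\<close> gives
    \<open>k\<^sup>2 / \<epsilon>\<^sup>2\<close>, each times \<open>h\<^sup>2 * B\<close>; the
    terms in \<open>\<delta>\<close> come from \<open>A'\<close> and \<open>D\<close>.\<close>
  have lhs: "g + h * (a + q) - h * (\<delta> * (1 + k / \<epsilon>) + h * (B * ((2 * k + 1) / \<epsilon> + k\<^sup>2 / \<epsilon>\<^sup>2))) =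
      (g - (h * (k / \<epsilon>)) * (h * (k / \<epsilon>)) * B) + (h * a - h * (k / \<epsilon>) * (h * B) - h * \<delta>)
      + (h * q - e * B) - h * (k / \<epsilon>) * \<delta>"
    using eps by (simp add: e_def field_simps power2_eq_square)
  show ?thesis unfolding lhs rhs by (intro diff_mono add_mono A' C D E)
qed

text \<open>The deficit from the fixed point \<open>c / \<beta>\<close> shrinks by the factor
  \<open>1 - \<beta> * x / m\<close> in each step; \<open>\<beta> * x \<le> m\<close> keeps this
  factor nonnegative, and its \<open>m\<close>-th power is at most
  \<open>exp (- (\<beta> * x))\<close>.\<close>

lemma discrete_gronwall:
  fixes g :: "nat \<Rightarrow> real"
  assumes \<beta>: "0 < \<beta>" and c: "0 \<le> c" and g0: "0 \<le> g 0" and x: "0 \<le> x" and m: "0 < m" "\<beta> * x \<le> real m"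
    and step: "\<And>i. i < m \<Longrightarrow> g (Suc i) \<ge> g i + x / real m * (c - \<beta> * g i)"
  shows "g m \<ge> c / \<beta> * (1 - exp (- (\<beta> * x)))"
proof -
  let ?r = "1 - \<beta> * x / real m"
  have r: "0 \<le> ?r" using m by simp
  have "c / \<beta> - g i \<le> ?r ^ i * (c / \<beta>)" if "i \<le> m" for i
    using that
  proof (induction i)
    case (Suc i)
    have "c / \<beta> - g (Suc i) \<le> c / \<beta> - (g i + x / real m * (c - \<beta> * g i))"
      using step[of i] Suc.prems by simp
    also have "\<dots> = ?r * (c / \<beta> - g i)"
      using \<beta> m by (simp add: field_simps)
    also have "\<dots> \<le> ?r * (?r ^ i * (c / \<beta>))" using Suc r by (intro mult_left_mono) auto
    finally show ?case by simp
  qed (use g0 in simp)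
  from this[of m] have "c / \<beta> - g m \<le> ?r ^ m * (c / \<beta>)" by simp
  also have "\<dots> \<le> exp (- (\<beta> * x)) * (c / \<beta>)"
    using c \<beta> m exp_ge_one_minus_x_over_n_power_n[of "\<beta> * x" m] by (intro mult_right_mono) auto
  finally show ?thesis by (simp add: algebra_simps)
qed

text \<open>Almost surely the number of calls is \<open>N 1\<close>, a Poisson variable. Passing
  through the nonnegative integral gives integrability together with the value.\<close>

lemma (in greedy_run) expected_num_calls:
  "integrable M (\<lambda>\<omega>. real (num_calls \<epsilon> N \<omega>))"
  "(\<integral>\<omega>. real (num_calls \<epsilon> N \<omega>) \<partial>M) = real k * ln (1 / \<epsilon>)"
proof -
  let ?l = "real k * ln (1 / \<epsilon>)"
  have N1[measurable]: "N 1 \<in> M \<rightarrow>\<^sub>M count_space UNIV" using N_measurable eps_le by simp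
  note [measurable] = num_calls_measurable
  have l: "0 \<le> ?l" using eps_pos eps_le by simp
  have p: "prob {\<omega> \<in> space M. N 1 \<omega> = n} = ?l ^ n / fact n * exp (- ?l)" for n
  proof -
    have "{\<omega> \<in> space M. N 1 \<omega> = n} = {\<omega> \<in> space M. N 1 \<omega> - N \<epsilon> \<omega> = n}" using N_start by auto
    then show ?thesis using increment_prob[of \<epsilon> 1 n] eps_le by simp
  qed
  have "(\<integral>\<^sup>+\<omega>. ennreal (real (N 1 \<omega>)) \<partial>M) =
      (\<integral>\<^sup>+\<omega>. (\<Sum>n. ennreal (real n) * indicator {\<omega> \<in> space M. N 1 \<omega> = n} \<omega>) \<partial>M)"
  proof (rule nn_integral_cong)
    fix \<omega> assume \<omega>: "\<omega> \<in> space M"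
    have "(\<Sum>n. ennreal (real n) * indicator {\<omega> \<in> space M. N 1 \<omega> = n} \<omega>) =
      (\<Sum>n\<in>{N 1 \<omega>}. ennreal (real n) * indicator {\<omega> \<in> space M. N 1 \<omega> = n} \<omega>)"
      by (rule suminf_finite) auto
    then show "ennreal (real (N 1 \<omega>)) = (\<Sum>n. ennreal (real n) * indicator {\<omega> \<in> space M. N 1 \<omega> = n} \<omega>)"
      using \<omega> by simp
  qed
  also have "\<dots> = (\<Sum>n. \<integral>\<^sup>+\<omega>. ennreal (real n) * indicator {\<omega> \<in> space M. N 1 \<omega> = n} \<omega> \<partial>M)"
    by (rule nn_integral_suminf) measurable
  also have "\<dots> = (\<Sum>n. ennreal (real n * (?l ^ n / fact n * exp (- ?l))))"
  proof (rule suminf_cong)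
    fix n
    have "{\<omega> \<in> space M. N 1 \<omega> = n} \<in> events" by measurable
    then have "(\<integral>\<^sup>+\<omega>. ennreal (real n) * indicator {\<omega> \<in> space M. N 1 \<omega> = n} \<omega> \<partial>M) =
        ennreal (real n) * ennreal (?l ^ n / fact n * exp (- ?l))"
      by (simp only: nn_integral_cmult_indicator emeasure_eq_measure p)
    also have "\<dots> = ennreal (real n * (?l ^ n / fact n * exp (- ?l)))"
      by (rule ennreal_mult[symmetric]) (use l in auto)
    finally show "(\<integral>\<^sup>+\<omega>. ennreal (real n) * indicator {\<omega> \<in> space M. N 1 \<omega> = n} \<omega> \<partial>M) =
        ennreal (real n * (?l ^ n / fact n * exp (- ?l)))" .
  qed
  also have "\<dots> = ennreal ?l"
    by (rule suminf_ennreal_eq[OF _ sums_poisson_mean]) (use l in simp)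
  finally have "(\<integral>\<^sup>+\<omega>. ennreal (real (N 1 \<omega>)) \<partial>M) = ennreal ?l" .
  moreover have "(\<integral>\<^sup>+\<omega>. ennreal (real (num_calls \<epsilon> N \<omega>)) \<partial>M) = (\<integral>\<^sup>+\<omega>. ennreal (real (N 1 \<omega>)) \<partial>M)"
    using AE_num_calls by (intro nn_integral_cong_AE) auto
  ultimately have "integrable M (\<lambda>\<omega>. real (num_calls \<epsilon> N \<omega>)) \<and> (\<integral>\<omega>. real (num_calls \<epsilon> N \<omega>) \<partial>M) = ?l"
    by (subst nn_integral_eq_integrable[symmetric]) (use l in auto)
  then show "integrable M (\<lambda>\<omega>. real (num_calls \<epsilon> N \<omega>))"
    "(\<integral>\<omega>. real (num_calls \<epsilon> N \<omega>) \<partial>M) = real k * ln (1 / \<epsilon>)" by auto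
qed

section \<open>Drift of the process under an approximate swap procedure\<close>

locale approximate_greedy_run = greedy_run U Ind \<epsilon> M N swap A\<^sub>0 S + monotone_submodular U f
  for U :: "'a set" and Ind \<epsilon> and M :: "'w measure" and N swap A\<^sub>0 S f +
  fixes Opt :: "'a set" and \<beta> \<eta> :: real
  assumes beta_pos: "0 < \<beta>" and eta_nonneg: "0 \<le> \<eta>"
    and opt: "optimal_base Ind f Opt"
    and swap_approx: "approximate_swap U Ind f Opt \<epsilon> \<beta> \<eta> swap"
begin

lemma Opt_subset: "Opt \<subseteq> U"
  using opt base_subset by (simp add: optimal_base_def)

lemma f_Opt_nonneg: "0 \<le> f Opt"
  using f_nonneg Opt_subset by simp

text \<open>The last conclusion rests on maximality of bases: \<open>j\<close> in
  \<open>A - {i}\<close> would make \<open>A - {i}\<close> itself a base, properly contained in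
  \<open>A\<close>.\<close>

lemma swap_in:
  assumes "A \<in> bases Ind" "t \<in> {\<epsilon>..1}" "(i, j) \<in> set_pmf (swap t A)"
  shows "i \<in> A" "j \<in> U" "j \<notin> A - {i}"
proof -
  have *: "i \<in> A \<and> j \<in> U \<and> apply_swap A (i, j) \<in> bases Ind"
    using swap_proc assms by (fastforce simp: swap_procedure_def)
  then show "i \<in> A" "j \<in> U" by auto
  show "j \<notin> A - {i}"
  proof
    assume "j \<in> A - {i}"
    then have "apply_swap A (i, j) = A - {i}" by (auto simp: apply_swap_def)
    then have "A - {i} \<in> bases Ind" using * by simp
    then have "A = A - {i}" using assms(1) by (auto simp: bases_def)
    then show False using * by auto
  qed
qed

text \<open>The support of a swap is nonempty, and the first component of any pair in it lies in the
  given base, which is therefore nonempty.\<close>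

lemma k_pos: "0 < k"
proof -
  obtain p where "p \<in> set_pmf (swap \<epsilon> A\<^sub>0)" using set_pmf_not_empty by fast
  then have "fst p \<in> A\<^sub>0" using swap_in(1)[OF A0_base, of \<epsilon> "fst p" "snd p"] eps_le by simp
  moreover have "finite A\<^sub>0" using A0_base base_subset finite_ground finite_subset by blast
  ultimately have "0 < card A\<^sub>0" by (auto simp: card_gt_0_iff)
  moreover have "finite Ind" using finite_subset[of Ind "Pow U"] indep_subset_ground finite_ground by auto
  then have "card A\<^sub>0 \<le> k" using A0_base unfolding matroid_rank_def bases_def by (intro Max_ge) auto
  ultimately show ?thesis by simp
qed

definition cur_grad :: "real \<Rightarrow> 'a set \<Rightarrow> real" where
  "cur_grad t A = (\<Sum>a\<in>A. grad_at U f t A a)"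

definition opt_grad :: "real \<Rightarrow> 'a set \<Rightarrow> real" where
  "opt_grad t A = (\<Sum>u\<in>Opt. grad_at U f t A u)"

text \<open>\<open>t / k * net_gain t A\<close> will bound the mean gain of one swap from below, so
  at rate \<open>k / t\<close> swaps contribute at least \<open>net_gain t A\<close> per unit of
  time.\<close>

definition net_gain :: "real \<Rightarrow> 'a set \<Rightarrow> real" where
  "net_gain t A = \<beta> * opt_grad t A - cur_grad t A - \<eta> * f Opt"

text \<open>A crude common bound on \<open>scaled\<close>, \<open>cur_grad\<close> and the absolute
  value of \<open>net_gain\<close> for times in \<open>[0, 1]\<close>; it becomes the
  \<open>B\<close> of \<open>poisson_step_bound\<close>.\<close>

definition grad_bound :: real where
  "grad_bound = (\<beta> + 1) * (real (card U) * f U) + \<eta> * f Opt + f U"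

lemma f_U_nonneg: "0 \<le> f U"
  using f_nonneg by simp

lemma sum_grad_bounds:
  assumes "0 \<le> t" "t \<le> 1" "Q \<subseteq> U"
  shows "0 \<le> (\<Sum>a\<in>Q. grad_at U f t A a)" "(\<Sum>a\<in>Q. grad_at U f t A a) \<le> real (card U) * f U"
proof -
  show "0 \<le> (\<Sum>a\<in>Q. grad_at U f t A a)"
    using assms grad_bounds by (intro sum_nonneg) auto
  have "(\<Sum>a\<in>Q. grad_at U f t A a) \<le> (\<Sum>a\<in>U. grad_at U f t A a)"
    using assms grad_bounds finite_U by (intro sum_mono2) auto
  also have "\<dots> \<le> real (card U) * f U"
    using assms grad_bounds by (intro sum_bounded_above) auto
  finally show "(\<Sum>a\<in>Q. grad_at U f t A a) \<le> real (card U) * f U" .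
qed

lemma grad_bound_bounds:
  assumes t: "0 \<le> t" "t \<le> 1" "A \<subseteq> U"
  shows "0 \<le> cur_grad t A" "cur_grad t A \<le> grad_bound" "\<bar>net_gain t A\<bar> \<le> grad_bound"
    "scaled t A \<le> grad_bound" "0 \<le> opt_grad t A"
proof -
  note a = sum_grad_bounds[OF t, of A, folded cur_grad_def]
  note b = sum_grad_bounds[OF t(1,2) Opt_subset, of A, folded opt_grad_def]
  note c = scaled_bounds[OF t(1,2), of A] f_U_nonneg
  have d: "0 \<le> \<eta> * f Opt" using eta_nonneg f_Opt_nonneg by simp
  have e: "0 \<le> \<beta> * opt_grad t A" "\<beta> * opt_grad t A \<le> \<beta> * (real (card U) * f U)"
    using b beta_pos by auto
  have g: "grad_bound = \<beta> * (real (card U) * f U) + real (card U) * f U + \<eta> * f Opt + f U"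
    by (simp add: grad_bound_def distrib_right)
  have z: "0 \<le> real (card U) * f U" using a by linarith
  show "0 \<le> cur_grad t A" "0 \<le> opt_grad t A" using a b by auto
  show "cur_grad t A \<le> grad_bound" "scaled t A \<le> grad_bound" using a c d e z unfolding g by linarith+
  show "\<bar>net_gain t A\<bar> \<le> grad_bound"
    unfolding net_gain_def g abs_le_iff using a b c d e z by linarith
qed

lemma continuous_on_gains:
  assumes "A \<subseteq> U"
  shows "continuous_on X (\<lambda>t. cur_grad t A)" "continuous_on X (\<lambda>t. t / real k * net_gain t A)"
proof -
  have 1: "continuous_on X (\<lambda>t. \<Sum>a\<in>Q. grad_at U f t A a)" if "Q \<subseteq> U" for Q
    using that by (intro continuous_on_sum continuous_on_grad_at finite_U) auto
  show "continuous_on X (\<lambda>t. cur_grad t A)" unfolding cur_grad_def using 1[OF assms] .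
  show "continuous_on X (\<lambda>t. t / real k * net_gain t A)"
    unfolding net_gain_def cur_grad_def opt_grad_def using k_pos
    by (intro continuous_intros 1 assms Opt_subset) auto
qed

text \<open>The approximation inequality is multiplied by \<open>t\<close>, and
  \<open>scaled_swap_ge\<close> is averaged over the pairs in the support; pairs outside it have
  weight zero.\<close>

lemma swap_drift:
  assumes A: "A \<in> bases Ind" and t: "t \<in> {\<epsilon>..1}"
  shows "scaled t A + t / real k * net_gain t A \<le>
    (\<Sum>p\<in>U \<times> U. swap_prob A p t * scaled t (apply_swap A p))"
proof -
  let ?g = "\<lambda>i. grad_at U f t A i"
  have t01: "0 \<le> t" "t \<le> 1" using t eps_pos by auto
  have sub: "set_pmf (swap t A) \<subseteq> U \<times> U"
    using swap_in[OF A t] base_subset[OF A] by auto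
  have "measure_pmf.expectation (swap t A) (\<lambda>(i, j). ?g j - ?g i) =
    (\<Sum>p\<in>U \<times> U. (case p of (i, j) \<Rightarrow> ?g j - ?g i) * pmf (swap t A) p)"
    by (rule integral_measure_pmf_real) (use sub finite_UU in auto)
  moreover have "measure_pmf.expectation (swap t A) (\<lambda>(i, j). ?g j - ?g i) \<ge>
      \<beta> / real k * opt_grad t A - 1 / real k * cur_grad t A - \<eta> / real k * f Opt"
    using swap_approx A t by (simp add: approximate_swap_def opt_grad_def cur_grad_def)
  ultimately have "t * (\<beta> / real k * opt_grad t A - 1 / real k * cur_grad t A - \<eta> / real k * f Opt) \<le>
      t * (\<Sum>p\<in>U \<times> U. (case p of (i, j) \<Rightarrow> ?g j - ?g i) * pmf (swap t A) p)"
    using t01 by (intro mult_left_mono) auto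
  moreover have "t * (\<beta> / real k * opt_grad t A - 1 / real k * cur_grad t A - \<eta> / real k * f Opt) =
      t / real k * net_gain t A"
    using k_pos by (simp add: net_gain_def field_simps)
  ultimately have "scaled t A + t / real k * net_gain t A \<le>
      scaled t A * (\<Sum>p\<in>U \<times> U. pmf (swap t A) p) +
      t * (\<Sum>p\<in>U \<times> U. (case p of (i, j) \<Rightarrow> ?g j - ?g i) * pmf (swap t A) p)"
    using sum_pmf_eq_1[OF finite_UU sub] by simp
  also have "\<dots> = (\<Sum>p\<in>U \<times> U. pmf (swap t A) p * (scaled t A + t * (case p of (i, j) \<Rightarrow> ?g j - ?g i)))"
    by (simp add: sum_distrib_left sum.distrib distrib_left mult_ac)
  also have "\<dots> \<le> (\<Sum>p\<in>U \<times> U. pmf (swap t A) p * scaled t (apply_swap A p))"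
  proof (rule sum_mono)
    fix p :: "'a \<times> 'a"
    obtain i j where p: "p = (i, j)" by (cases p)
    show "pmf (swap t A) p * (scaled t A + t * (case p of (i, j) \<Rightarrow> ?g j - ?g i)) \<le>
        pmf (swap t A) p * scaled t (apply_swap A p)"
    proof (cases "p \<in> set_pmf (swap t A)")
      case True
      then have "t * (?g j - ?g i) \<le> scaled t (apply_swap A (i, j)) - scaled t A"
        using swap_in[OF A t, of i j] base_subset[OF A] t01 p by (intro scaled_swap_ge) auto
      then show ?thesis by (intro mult_left_mono) (auto simp: p)
    next
      case False
      then have "pmf (swap t A) p = 0" by (simp add: pmf_eq_0_set_pmf)
      then show ?thesis by simp
    qed
  qed
  also have "\<dots> = (\<Sum>p\<in>U \<times> U. swap_prob A p t * scaled t (apply_swap A p))"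
    using t by (simp add: swap_prob_eq)
  finally show ?thesis .
qed

section \<open>The potential: growth over one step and over the whole interval\<close>

definition potential :: "real \<Rightarrow> real" where
  "potential t = (\<integral>\<omega>. scaled t (cur (N t \<omega>) \<omega>) \<partial>M)"

lemma integrable_cur:
  assumes "t \<in> {\<epsilon>..1}"
  shows "integrable M (\<lambda>\<omega>. \<phi> (cur (N t \<omega>) \<omega>) :: real)"
proof -
  obtain c where c: "\<And>A. A \<subseteq> U \<Longrightarrow> \<bar>\<phi> A\<bar> \<le> c" "0 \<le> c" using bounded_on_sets by blast
  show ?thesis
    by (rule integrable_bounded[where c=c])
      (use borel_measurable_of_count[OF cur_at_measurable[OF assms, of 0]] c(1) cur_subset in auto)
qed

lemma potential_bounds:
  assumes "t \<in> {\<epsilon>..1}"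
  shows "0 \<le> potential t" "potential t \<le> grad_bound"
proof -
  have t: "0 \<le> t" "t \<le> 1" using assms eps_pos by auto
  show "0 \<le> potential t" unfolding potential_def using scaled_bounds[OF t] by (intro integral_nonneg_AE) auto
  have "potential t \<le> (\<integral>\<omega>. grad_bound \<partial>M)"
    unfolding potential_def using grad_bound_bounds(4)[OF t] cur_subset
    by (intro integral_mono integrable_cur assms) (auto simp: eps_le)
  then show "potential t \<le> grad_bound" by (simp add: prob_space)
qed

text \<open>The hypotheses \<open>mod\<close> allow gradients inside the step to be replaced by
  those at \<open>t\<close> at cost \<open>\<delta>\<close>. No event and exactly one event give the
  two terms on the right of \<open>poisson_step_bound\<close>; there \<open>a\<close> and
  \<open>q\<close> stand for the expected \<open>cur_grad\<close> and \<open>net_gain\<close> at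
  time \<open>t\<close>.\<close>

lemma potential_step:
  assumes \<delta>: "0 \<le> \<delta>" and h: "0 < h" "h \<le> \<epsilon>" and t: "t \<in> {\<epsilon>..1}" "t + h \<le> 1"
    and mod: "\<And>A s. A \<subseteq> U \<Longrightarrow> s \<in> {t..t + h} \<Longrightarrow> \<bar>cur_grad s A - cur_grad t A\<bar> \<le> \<delta>"
      "\<And>A s. A \<subseteq> U \<Longrightarrow> s \<in> {t..t + h} \<Longrightarrow>
        \<bar>s / real k * net_gain s A - t / real k * net_gain t A\<bar> \<le> \<delta>"
  shows "potential (t + h) \<ge> potential t + h * ((\<beta> - \<eta>) * f Opt - \<beta> * potential t) -
    h * (\<delta> * (1 + real k / \<epsilon>) + h * (grad_bound * ((2 * real k + 1) / \<epsilon> + (real k)\<^sup>2 / \<epsilon>\<^sup>2)))"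
proof -
  define u where "u = t + h"
  have u: "u \<in> {t..1}" "u \<in> {\<epsilon>..1}" "t < u" using t h by (auto simp: u_def)
  have t01: "0 \<le> t" "t \<le> 1" "0 \<le> u" "u \<le> 1" using t u eps_pos by auto
  define l where "l = real k * ln (u / t)"
  let ?X = "\<lambda>\<omega>. cur (N t \<omega>) \<omega>"
  let ?D = "\<lambda>d \<omega>. indicator {d} (N u \<omega> - N t \<omega>) :: real"
  have N: "N u \<in> M \<rightarrow>\<^sub>M count_space UNIV" "N t \<in> M \<rightarrow>\<^sub>M count_space UNIV"
    using N_measurable t u by auto
  then have Dm[measurable]: "?D d \<in> borel_measurable M" for d by measurable
  have P0: "prob {\<omega> \<in> space M. N u \<omega> - N t \<omega> = 0} = exp (- l)"
    and P1: "prob {\<omega> \<in> space M. N u \<omega> - N t \<omega> = 1} = l * exp (- l)"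
    using increment_prob[of t u 0] increment_prob[of t u 1] t u by (simp_all add: l_def)
  define a where "a = (\<integral>\<omega>. cur_grad t (?X \<omega>) \<partial>M)"
  define q where "q = (\<integral>\<omega>. net_gain t (?X \<omega>) \<partial>M)"
  note int = integrable_cur[OF t(1)]
  have a_bounds: "0 \<le> a" "a \<le> grad_bound"
  proof -
    show "0 \<le> a" unfolding a_def using grad_bound_bounds(1)[OF t01(1,2)] cur_subset
      by (intro integral_nonneg_AE AE_I2) auto
    have "a \<le> (\<integral>\<omega>. grad_bound \<partial>M)"
      unfolding a_def using grad_bound_bounds(2)[OF t01(1,2)] cur_subset by (intro integral_mono int) auto
    then show "a \<le> grad_bound" by (simp add: prob_space)
  qed
  have q_bound: "\<bar>q\<bar> \<le> grad_bound"
  proof -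
    have "\<bar>q\<bar> \<le> (\<integral>\<omega>. \<bar>net_gain t (?X \<omega>)\<bar> \<partial>M)" unfolding q_def by (rule integral_abs_bound)
    also have "\<dots> \<le> (\<integral>\<omega>. grad_bound \<partial>M)"
      using grad_bound_bounds(3)[OF t01(1,2)] cur_subset
      by (intro integral_mono integrable_abs int) auto
    finally show ?thesis by (simp add: prob_space)
  qed
  have aq: "a + q \<ge> (\<beta> - \<eta>) * f Opt - \<beta> * potential t"
  proof -
    have "(\<integral>\<omega>. (\<beta> - \<eta>) * f Opt - \<beta> * scaled t (?X \<omega>) \<partial>M) \<le> (\<integral>\<omega>. cur_grad t (?X \<omega>) + net_gain t (?X \<omega>) \<partial>M)"
    proof (intro integral_mono Bochner_Integration.integrable_add Bochner_Integration.integrable_diff integrable_mult_right int)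
      fix \<omega>
      have "\<beta> * (f Opt - scaled t (?X \<omega>)) \<le> \<beta> * opt_grad t (?X \<omega>)"
        using scaled_gap[OF t01(1,2) Opt_subset] beta_pos unfolding opt_grad_def
        by (intro mult_left_mono) auto
      then show "(\<beta> - \<eta>) * f Opt - \<beta> * scaled t (?X \<omega>) \<le> cur_grad t (?X \<omega>) + net_gain t (?X \<omega>)"
        by (simp add: net_gain_def algebra_simps)
    qed
    also have "\<dots> = a + q" unfolding a_def q_def by (intro Bochner_Integration.integral_add int)
    also have "(\<integral>\<omega>. (\<beta> - \<eta>) * f Opt - \<beta> * scaled t (?X \<omega>) \<partial>M) = (\<beta> - \<eta>) * f Opt - \<beta> * potential t"
      unfolding potential_def
      by (subst Bochner_Integration.integral_diff) (auto intro!: integrable_mult_right int simp: prob_space)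
    finally show ?thesis .
  qed
  have no_event: "(\<integral>\<omega>. scaled u (?X \<omega>) \<partial>M) \<ge> potential t + h * (a - \<delta>)"
  proof -
    have "potential t + h * (a - \<delta>) = (\<integral>\<omega>. scaled t (?X \<omega>) + h * (cur_grad t (?X \<omega>) - \<delta>) \<partial>M)"
      unfolding potential_def a_def
      by (subst Bochner_Integration.integral_add)
        (auto intro!: integrable_mult_right Bochner_Integration.integrable_diff int simp: Bochner_Integration.integral_diff int prob_space)
    also have "\<dots> \<le> (\<integral>\<omega>. scaled u (?X \<omega>) \<partial>M)"
    proof (intro integral_mono Bochner_Integration.integrable_add Bochner_Integration.integrable_diff integrable_mult_right int)
      fix \<omega> assume \<omega>: "\<omega> \<in> space M"
      \<comment> \<open>\<open>scaled_diff_ge\<close> supplies the gradient at the end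
        \<open>u\<close> of the step; \<open>mod\<close> relates it to the one at
        \<open>t\<close>.\<close>
      have "h * (cur_grad t (?X \<omega>) - \<delta>) \<le> h * cur_grad u (?X \<omega>)"
        using mod(1)[OF cur_subset[OF \<omega>, of "N t \<omega>"], of u] h u
        by (intro mult_left_mono) (simp_all add: u_def abs_le_iff)
      also have "\<dots> \<le> scaled u (?X \<omega>) - scaled t (?X \<omega>)"
        using scaled_diff_ge[of t u "?X \<omega>"] cur_subset[OF \<omega>] t01 u by (simp add: cur_grad_def u_def)
      finally show "scaled t (?X \<omega>) + h * (cur_grad t (?X \<omega>) - \<delta>) \<le> scaled u (?X \<omega>)" by simp
    qed
    finally show ?thesis .
  qed
  \<comment> \<open>Subtracting \<open>\<delta>\<close> makes the bound valid for a swap at any time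
    of the step.\<close>
  define \<psi> where "\<psi> A = scaled t A + t / real k * net_gain t A - \<delta>" for A
  have \<psi>_int: "(\<integral>\<omega>. \<psi> (?X \<omega>) \<partial>M) = potential t + t / real k * q - \<delta>"
    unfolding potential_def q_def \<psi>_def
    by (subst Bochner_Integration.integral_diff)
      (auto intro!: integrable_mult_right Bochner_Integration.integrable_add int simp: Bochner_Integration.integral_add int prob_space)
  have one_event: "(potential t + t / real k * q - \<delta>) * (l * exp (- l)) \<le>
      (\<integral>\<omega>. scaled u (cur (N t \<omega> + 1) \<omega>) * ?D 1 \<omega> \<partial>M)"
  proof -
    have "(\<integral>\<omega>. \<psi> (?X \<omega>) \<partial>M) * prob {\<omega> \<in> space M. N u \<omega> - N t \<omega> = 1} \<le>
        (\<integral>\<omega>. scaled u (cur (N t \<omega> + 1) \<omega>) * ?D 1 \<omega> \<partial>M)"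
    proof (rule single_event_expectation_ge[OF t(1) u(1)])
      fix A s assume A: "A \<in> bases Ind" and s: "s \<in> {t..u}"
      have s': "s \<in> {\<epsilon>..1}" "0 \<le> s" "s \<le> 1" using s t u eps_pos by auto
      \<comment> \<open>Monotonicity in the time absorbs the remaining differences:
        \<open>scaled t\<close> is below \<open>scaled s\<close> before the swap, and
        \<open>scaled s\<close> is below \<open>scaled u\<close> after it.\<close>
      have "\<psi> A \<le> scaled s A + s / real k * net_gain s A"
        using scaled_mono[OF t01(1), of s A] mod(2)[OF base_subset[OF A], of s] s s'
        by (auto simp: \<psi>_def u_def abs_le_iff)
      also have "\<dots> \<le> (\<Sum>p\<in>U \<times> U. swap_prob A p s * scaled s (apply_swap A p))"
        by (rule swap_drift[OF A s'(1)])
      also have "\<dots> \<le> (\<Sum>p\<in>U \<times> U. swap_prob A p s * scaled u (apply_swap A p))"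
        using s s' t01 swap_prob_bounds by (intro sum_mono mult_left_mono scaled_mono) auto
      finally show "\<psi> A \<le> (\<Sum>p\<in>U \<times> U. swap_prob A p s * scaled u (apply_swap A p))" .
    qed
    then show ?thesis unfolding \<psi>_int P1 .
  qed
  have Y: "integrable M (\<lambda>\<omega>. scaled u (cur (N t \<omega> + m) \<omega>) * ?D d \<omega>)" for m d
  proof (rule integrable_bounded[where c="f U"])
    show "(\<lambda>\<omega>. scaled u (cur (N t \<omega> + m) \<omega>) * ?D d \<omega>) \<in> borel_measurable M"
      by (intro borel_measurable_times Dm borel_measurable_of_count[OF cur_at_measurable[OF t(1)]])
    show "\<bar>scaled u (cur (N t \<omega> + m) \<omega>) * ?D d \<omega>\<bar> \<le> f U" for \<omega>
      using scaled_bounds[OF t01(3,4), of "cur (N t \<omega> + m) \<omega>"] f_U_nonneg by (auto simp: indicator_def)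
  qed
  have "exp (- l) * (potential t + h * (a - \<delta>)) + l * exp (- l) * (potential t + t / real k * q - \<delta>) \<le>
      (\<integral>\<omega>. scaled u (?X \<omega>) \<partial>M) * exp (- l) + (\<integral>\<omega>. scaled u (cur (N t \<omega> + 1) \<omega>) * ?D 1 \<omega> \<partial>M)"
    using mult_left_mono[OF no_event, of "exp (- l)"] one_event
    unfolding mult.commute[of _ "exp (- l)"] mult.commute[of "potential t + t / real k * q - \<delta>"]
    by (intro add_mono) simp_all
  also have "(\<integral>\<omega>. scaled u (?X \<omega>) \<partial>M) * exp (- l) = (\<integral>\<omega>. scaled u (cur (N t \<omega> + 0) \<omega>) * ?D 0 \<omega> \<partial>M)"
    unfolding P0[symmetric] add_0_right by (rule current_set_increment_indep[OF t(1) u(1), symmetric])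
  also have "\<dots> + (\<integral>\<omega>. scaled u (cur (N t \<omega> + 1) \<omega>) * ?D 1 \<omega> \<partial>M) =
      (\<integral>\<omega>. scaled u (cur (N t \<omega> + 0) \<omega>) * ?D 0 \<omega> + scaled u (cur (N t \<omega> + 1) \<omega>) * ?D 1 \<omega> \<partial>M)"
    by (rule Bochner_Integration.integral_add[symmetric]) (rule Y)+
  also have "\<dots> \<le> potential u"
    unfolding potential_def
  proof (intro integral_mono Bochner_Integration.integrable_add Y integrable_cur u)
    fix \<omega> assume \<omega>: "\<omega> \<in> space M"
    have le: "N t \<omega> \<le> N u \<omega>" using N_mono[OF \<omega>] t u by auto
    have pos: "0 \<le> scaled u (cur (N u \<omega>) \<omega>)" using scaled_bounds[OF t01(3,4)] by simp
    consider "N u \<omega> = N t \<omega> + 0" | "N u \<omega> = N t \<omega> + 1" | "2 \<le> N u \<omega> - N t \<omega>" using le by linarith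
    then show "scaled u (cur (N t \<omega> + 0) \<omega>) * ?D 0 \<omega> + scaled u (cur (N t \<omega> + 1) \<omega>) * ?D 1 \<omega> \<le>
        scaled u (cur (N u \<omega>) \<omega>)"
    proof cases
      case 1 then show ?thesis by simp
    next
      case 2 then show ?thesis by simp
    next
      \<comment> \<open>With two or more events both indicators vanish, and nonnegativity of
        \<open>scaled\<close> suffices.\<close>
      case 3
      then have "?D 0 \<omega> = 0" "?D 1 \<omega> = 0" by auto
      then show ?thesis using pos by simp
    qed
  qed
  finally have "exp (- l) * (potential t + h * (a - \<delta>)) + l * exp (- l) * (potential t + t / real k * q - \<delta>) \<le> potential u" .
  moreover have "potential t + h * (a + q) - h * (\<delta> * (1 + real k / \<epsilon>) +
      h * (grad_bound * ((2 * real k + 1) / \<epsilon> + (real k)\<^sup>2 / \<epsilon>\<^sup>2))) \<le>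
      exp (- l) * (potential t + h * (a - \<delta>)) + l * exp (- l) * (potential t + t / real k * q - \<delta>)"
    using t k_pos eps_pos h \<delta> q_bound a_bounds potential_bounds[OF t(1)]
    by (intro poisson_step_bound) (auto simp: l_def u_def)
  moreover have "h * ((\<beta> - \<eta>) * f Opt - \<beta> * potential t) \<le> h * (a + q)"
    using aq h by (intro mult_left_mono) auto
  ultimately show ?thesis unfolding u_def by linarith
qed

text \<open>\<open>\<tau>\<close> is the part of the constant term given up to the step errors, one
  half to \<open>\<delta>\<close> and one half to the term quadratic in \<open>h\<close>. Its upper
  bound keeps the remaining constant nonnegative, as \<open>discrete_gronwall\<close>
  requires.\<close>

lemma potential_one_ge:
  assumes eps: "\<epsilon> < 1" and \<tau>: "0 < \<tau>" "\<tau> \<le> (\<beta> - \<eta>) * f Opt"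
  shows "potential 1 \<ge> ((\<beta> - \<eta>) * f Opt - \<tau>) / \<beta> * (1 - exp (- (\<beta> * (1 - \<epsilon>))))"
proof -
  define K where "K = grad_bound * ((2 * real k + 1) / \<epsilon> + (real k)\<^sup>2 / \<epsilon>\<^sup>2)"
  define \<delta> where "\<delta> = \<tau> / 2 / (1 + real k / \<epsilon>)"
  have K: "0 \<le> K" using eps_pos grad_bound_bounds(1,2)[of 0 "{}"] by (simp add: K_def)
  have k1: "0 < 1 + real k / \<epsilon>" using eps_pos by (simp add: add_pos_nonneg)
  have \<delta>: "0 < \<delta>" "\<delta> * (1 + real k / \<epsilon>) = \<tau> / 2"
    using \<tau> k1 nonzero_eq_divide_eq[THEN iffD1, OF _ \<delta>_def] by (simp_all add: \<delta>_def)
  obtain h1 where h1: "0 < h1" "\<And>A s t. A \<in> Pow U \<Longrightarrow> s \<in> {0..1} \<Longrightarrow> t \<in> {0..1} \<Longrightarrow> \<bar>s - t\<bar> \<le> h1 \<Longrightarrow>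
      \<bar>cur_grad s A - cur_grad t A\<bar> \<le> \<delta>"
    using uniform_modulus[of "Pow U" "\<lambda>A t. cur_grad t A" \<delta>] continuous_on_gains(1) finite_U \<delta>(1) by auto
  obtain h2 where h2: "0 < h2" "\<And>A s t. A \<in> Pow U \<Longrightarrow> s \<in> {0..1} \<Longrightarrow> t \<in> {0..1} \<Longrightarrow> \<bar>s - t\<bar> \<le> h2 \<Longrightarrow>
      \<bar>s / real k * net_gain s A - t / real k * net_gain t A\<bar> \<le> \<delta>"
    using uniform_modulus[of "Pow U" "\<lambda>A t. t / real k * net_gain t A" \<delta>] continuous_on_gains(2) finite_U \<delta>(1)
    by auto
  \<comment> \<open>\<open>h1\<close> and \<open>h2\<close> are the moduli,
    \<open>\<epsilon>\<close> is required by \<open>potential_step\<close>,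
    \<open>1 / \<beta>\<close> keeps the Gronwall factor nonnegative, and the last entry bounds the
    quadratic error; \<open>K + 1\<close> avoids division by zero.\<close>
  define r where "r = Min {h1, h2, \<epsilon>, 1 / \<beta>, \<tau> / 2 / (K + 1)}"
  have r: "0 < r" "r \<le> h1" "r \<le> h2" "r \<le> \<epsilon>" "r \<le> 1 / \<beta>" "r \<le> \<tau> / 2 / (K + 1)"
    using h1(1) h2(1) eps_pos beta_pos \<tau> K by (auto simp: r_def)
  obtain m where m: "(1 - \<epsilon>) / r < real m" using reals_Archimedean2 by blast
  define h where "h = (1 - \<epsilon>) / real m"
  have m0: "0 < m" using m r eps by (metis diff_gt_0_iff_gt divide_pos_pos of_nat_0_less_iff order.strict_trans)
  have h: "0 < h" "h \<le> r" using m m0 r eps by (auto simp: h_def field_simps)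
  have hm: "h * real m = 1 - \<epsilon>" using m0 by (simp add: h_def)
  have hK: "h * K \<le> \<tau> / 2"
  proof -
    have "h * K \<le> r * (K + 1)" using h K by (intro mult_mono) auto
    also have "\<dots> \<le> \<tau> / 2" using r(6) K by (simp add: field_simps)
    finally show ?thesis .
  qed
  have "potential (\<epsilon> + real m * h) \<ge>
      ((\<beta> - \<eta>) * f Opt - \<tau>) / \<beta> * (1 - exp (- (\<beta> * (1 - \<epsilon>))))"
  proof (rule discrete_gronwall)
    show "0 \<le> potential (\<epsilon> + real 0 * h)" using potential_bounds[of \<epsilon>] eps by simp
    show "\<beta> * (1 - \<epsilon>) \<le> real m"
    proof -
      have "\<beta> * h \<le> 1" using mult_left_mono[of h "1 / \<beta>" \<beta>] h r(5) beta_pos by simp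
      then show ?thesis using mult_right_mono[of "\<beta> * h" 1 "real m"] hm by (simp add: mult.assoc)
    qed
    fix i assume i: "i < m"
    define t where "t = \<epsilon> + real i * h"
    have "real (Suc i) * h \<le> real m * h" using i h by (intro mult_right_mono) auto
    then have t: "\<epsilon> \<le> t" "t + h \<le> 1" using h hm by (auto simp: t_def algebra_simps)
    have t': "t \<in> {\<epsilon>..1}" using t h by simp
    have Suc_t: "\<epsilon> + real (Suc i) * h = t + h" by (simp add: t_def algebra_simps)
    have "potential (t + h) \<ge> potential t + h * ((\<beta> - \<eta>) * f Opt - \<beta> * potential t) -
        h * (\<delta> * (1 + real k / \<epsilon>) + h * (grad_bound * ((2 * real k + 1) / \<epsilon> + (real k)\<^sup>2 / \<epsilon>\<^sup>2)))"
    proof (rule potential_step)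
      fix A s assume A: "A \<subseteq> U" and s: "s \<in> {t..t + h}"
      have s': "s \<in> {0..1}" "t \<in> {0..1}" "\<bar>s - t\<bar> \<le> h1" "\<bar>s - t\<bar> \<le> h2"
        using s t t' h r eps_pos by auto
      show "\<bar>cur_grad s A - cur_grad t A\<bar> \<le> \<delta>" using h1(2)[of A s t] A s' by simp
      show "\<bar>s / real k * net_gain s A - t / real k * net_gain t A\<bar> \<le> \<delta>" using h2(2)[of A s t] A s' by simp
    qed (use \<delta> h r t t' in auto)
    moreover have "h * (\<delta> * (1 + real k / \<epsilon>) + h * K) \<le> h * \<tau>"
      using h hK \<delta>(2) by (intro mult_left_mono) auto
    ultimately have "potential (t + h) \<ge> potential t + h * ((\<beta> - \<eta>) * f Opt - \<beta> * potential t) - h * \<tau>"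
      unfolding K_def by linarith
    also have "potential t + h * ((\<beta> - \<eta>) * f Opt - \<beta> * potential t) - h * \<tau> =
        potential t + h * ((\<beta> - \<eta>) * f Opt - \<tau> - \<beta> * potential t)" by (simp add: algebra_simps)
    finally show "potential (\<epsilon> + real (Suc i) * h) \<ge> potential (\<epsilon> + real i * h) +
        (1 - \<epsilon>) / real m * ((\<beta> - \<eta>) * f Opt - \<tau> - \<beta> * potential (\<epsilon> + real i * h))"
      unfolding h_def[symmetric] t_def[symmetric] Suc_t .
  qed (use beta_pos \<tau> eps m0 in auto)
  then show ?thesis using hm by (simp add: mult.commute)
qed

lemma potential_one_lower_bound:
  "potential 1 \<ge> (1 - \<epsilon>) * (1 - \<eta> / \<beta>) * (1 - exp (- \<beta>)) * f Opt"
proof -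
  let ?c = "(\<beta> - \<eta>) * f Opt"
  have c: "(1 - \<eta> / \<beta>) * f Opt = ?c / \<beta>" using beta_pos by (simp add: field_simps)
  have e: "0 \<le> (1 - \<epsilon>) * (1 - exp (- \<beta>))" using eps_le beta_pos by simp
  have rhs: "(1 - \<epsilon>) * (1 - \<eta> / \<beta>) * (1 - exp (- \<beta>)) * f Opt =
      ?c / \<beta> * ((1 - \<epsilon>) * (1 - exp (- \<beta>)))" unfolding c[symmetric] by simp
  have one: "(1::real) \<in> {\<epsilon>..1}" using eps_le by simp
  show ?thesis
  proof (cases "0 < ?c \<and> \<epsilon> < 1")
    \<comment> \<open>Here \<open>(\<beta> - \<eta>) * f Opt \<le> 0\<close> or
      \<open>\<epsilon> = 1\<close>, so the claimed bound is at most \<open>0\<close>, while the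
      potential is nonnegative.\<close>
    case False
    then have "?c / \<beta> * ((1 - \<epsilon>) * (1 - exp (- \<beta>))) \<le> 0"
    proof (cases "\<epsilon> < 1")
      case True
      then have "?c / \<beta> \<le> 0" using False beta_pos by (simp add: divide_nonpos_pos)
      then show ?thesis using e by (rule mult_nonpos_nonneg)
    next
      case False
      then show ?thesis using eps_le by simp
    qed
    then show ?thesis using potential_bounds(1)[OF one] rhs by linarith
  next
    case True
    let ?E = "1 - exp (- (\<beta> * (1 - \<epsilon>)))"
    have E: "0 \<le> ?E" "?E \<le> 1" using True beta_pos by auto
    have "?c / \<beta> * ?E \<le> potential 1 + e" if e: "0 < e" for e
    proof -
      \<comment> \<open>A slack of \<open>e\<close> in the result permits
        \<open>\<tau> = \<beta> * e\<close>, capped by \<open>?c\<close> as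
        \<open>potential_one_ge\<close> demands.\<close>
      define \<tau> where "\<tau> = min ?c (\<beta> * e)"
      have \<tau>: "0 < \<tau>" "\<tau> \<le> ?c" "\<tau> \<le> \<beta> * e" using True e beta_pos by (auto simp: \<tau>_def)
      have "?c / \<beta> * ?E = (?c - \<tau>) / \<beta> * ?E + \<tau> / \<beta> * ?E" by (simp add: diff_divide_distrib left_diff_distrib)
      moreover have "\<tau> / \<beta> * ?E \<le> e * 1"
        using \<tau> E e beta_pos by (intro mult_mono) (auto simp: field_simps)
      ultimately show ?thesis using potential_one_ge[OF _ \<tau>(1,2)] True by linarith
    qed
    then have lim: "?c / \<beta> * ?E \<le> potential 1" by (rule field_le_epsilon)
    \<comment> \<open>The point \<open>- (\<beta> * (1 - \<epsilon>))\<close> is a convex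
      combination of \<open>0\<close> and \<open>- \<beta>\<close> with weight
      \<open>1 - \<epsilon>\<close> on the latter.\<close>
    have "exp ((1 - (1 - \<epsilon>)) *\<^sub>R 0 + (1 - \<epsilon>) *\<^sub>R (- \<beta>)) \<le>
        (1 - (1 - \<epsilon>)) * exp 0 + (1 - \<epsilon>) * exp (- \<beta>)"
      using eps_pos eps_le by (intro convex_onD[OF exp_convex]) auto
    then have "(1 - \<epsilon>) * (1 - exp (- \<beta>)) \<le> ?E" by (simp add: algebra_simps)
    then have "?c / \<beta> * ((1 - \<epsilon>) * (1 - exp (- \<beta>))) \<le> ?c / \<beta> * ?E"
      using True beta_pos by (intro mult_left_mono) auto
    then show ?thesis using lim rhs by linarith
  qed
qed

lemma AE_output: "AE \<omega> in M. output_set \<epsilon> A\<^sub>0 N S \<omega> = cur (N 1 \<omega>) \<omega>"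
  using AE_num_calls by eventually_elim (simp add: output_set_def)

lemma output_measurable: "output_set \<epsilon> A\<^sub>0 N S \<in> M \<rightarrow>\<^sub>M count_space UNIV"
  unfolding output_set_def[abs_def]
  by (rule measurable_compose_countable[where g="num_calls \<epsilon> N"]) (use cur_measurable num_calls_measurable in auto)

lemma output_base: "AE \<omega> in M. output_set \<epsilon> A\<^sub>0 N S \<omega> \<in> bases Ind"
proof -
  have "AE \<omega> in M. \<forall>n. n \<le> N 1 \<omega> \<longrightarrow> cur n \<omega> \<in> bases Ind"
    using AE_cur_base by (simp add: AE_all_countable)
  with AE_output show ?thesis by eventually_elim auto
qed

lemma integrable_output: "integrable M (\<lambda>\<omega>. f (output_set \<epsilon> A\<^sub>0 N S \<omega>))"
proof (rule integrable_bounded[where c="f U"])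
  show "(\<lambda>\<omega>. f (output_set \<epsilon> A\<^sub>0 N S \<omega>)) \<in> borel_measurable M"
    by (rule borel_measurable_of_count[OF output_measurable])
  show "\<bar>f (output_set \<epsilon> A\<^sub>0 N S \<omega>)\<bar> \<le> f U" if "\<omega> \<in> space M" for \<omega>
    using f_nonneg f_le cur_subset[OF that] by (simp add: output_set_def)
qed

text \<open>At time \<open>1\<close> the scaling is by \<open>1\<close>, so \<open>scaled\<close>
  agrees with \<open>f\<close>, and the number of calls is almost surely \<open>N 1\<close>.\<close>

lemma expected_output: "(\<integral>\<omega>. f (output_set \<epsilon> A\<^sub>0 N S \<omega>) \<partial>M) = potential 1"
  unfolding potential_def
proof (rule integral_cong_AE)
  show "(\<lambda>\<omega>. scaled 1 (cur (N 1 \<omega>) \<omega>)) \<in> borel_measurable M"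
    by (rule borel_measurable_integrable[OF integrable_cur]) (use eps_le in simp)
  show "AE \<omega> in M. f (output_set \<epsilon> A\<^sub>0 N S \<omega>) = scaled 1 (cur (N 1 \<omega>) \<omega>)"
    using AE_output AE_space by eventually_elim (simp add: scaled_one cur_subset)
qed (rule borel_measurable_integrable[OF integrable_output])

end

theorem theorem3p2:
  fixes U :: "'a set" and Ind :: "'a set set" and k :: nat
    and f :: "'a set \<Rightarrow> real" and Opt :: "'a set"
    and \<epsilon> \<beta> \<eta> :: real
    and swap :: "real \<Rightarrow> 'a set \<Rightarrow> ('a \<times> 'a) pmf"
    and A\<^sub>0 :: "'a set"
    and M :: "'w measure" and N :: "real \<Rightarrow> 'w \<Rightarrow> nat" and S :: "nat \<Rightarrow> 'w \<Rightarrow> 'a \<times> 'a"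
  assumes "matroid U Ind" and "matroid_rank Ind = k"
    and "\<And>X. X \<subseteq> U \<Longrightarrow> 0 \<le> f X" and "monotone_set_fun U f" and "submodular U f"
    and "0 < \<epsilon>" and "\<epsilon> \<le> 1"
    and "0 < \<beta>" and "\<beta> \<le> 1" and "0 \<le> \<eta>"
    and "optimal_base Ind f Opt"
    and "swap_procedure U Ind \<epsilon> swap"
    and "right_continuous_swap U Ind \<epsilon> swap"
    and "approximate_swap U Ind f Opt \<epsilon> \<beta> \<eta> swap"
    and "greedy_swap_poisson_process U Ind \<epsilon> swap A\<^sub>0 M N S"
  shows "(AE \<omega> in M. output_set \<epsilon> A\<^sub>0 N S \<omega> \<in> bases Ind)
    \<and> integrable M (\<lambda>\<omega>. f (output_set \<epsilon> A\<^sub>0 N S \<omega>))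
    \<and> (\<integral>\<omega>. f (output_set \<epsilon> A\<^sub>0 N S \<omega>) \<partial>M) \<ge> (1 - \<epsilon>) * (1 - \<eta> / \<beta>) * (1 - exp (- \<beta>)) * f Opt
    \<and> integrable M (\<lambda>\<omega>. real (num_calls \<epsilon> N \<omega>))
    \<and> (\<integral>\<omega>. real (num_calls \<epsilon> N \<omega>) \<partial>M) = real k * ln (1 / \<epsilon>)"
proof -
  interpret matroid U Ind by fact
  interpret approximate_greedy_run U Ind \<epsilon> M N swap A\<^sub>0 S f Opt \<beta> \<eta>
    by unfold_locales
      (use assms finite_ground in \<open>auto simp: greedy_swap_poisson_process_def\<close>)
  show ?thesis
    using output_base integrable_output potential_one_lower_bound expected_num_calls assms(2)
    by (simp add: expected_output)
qed

end
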